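(* Let $L$ be a link in $\mathbb{R}\mathrm{P}^3$ and let $D$ be a projective diagram of $L$, with the chain groups $C^i(D)$ and total differentials $d^{(i)}:C^i(D)\to C^{i-2}(D)$ constructed below (for any admissible choices of orientations and orderings). Then $d^{(i-2)}\circ d^{(i)}=0$ for every $i$, so $(C^\bullet(D),d)$ is a chain complex.
   Context: Diagrams. Identify $\mathbb{R}\mathrm{P}^3\setminus\{*\}$ with the twisted $I$-bundle $\mathbb{R}\mathrm{P}^2\tilde\times I$ and project links to $\mathbb{R}\mathrm{P}^2$, viewed as a 2-disk with antipodal boundary points identified. Two such (projective) diagrams represent ambient isotopic links iff they are related by the classical Reidemeister moves R-I, R-II, R-III together with two additional moves R-IV, R-V (Drobotukhina's moves acting across the boundary circle of the disk). Let $D$ be an oriented projective diagram with set of crossings $\mathcal{X}$, $|\mathcal{X}|=n$, ordered arbitrarily. Each crossing has a sign $\pm1$ by the right-hand rule. Each crossing can be smoothed in type $0$ (the Kauffman $A$-smoothing, carrying coefficient $A$ in the relation $L_\times=AL_0+A^{-1}L_\infty$) or type $1$ (the $B$-smoothing, coefficient $A^{-1}$). A state is $s\in\{0,1\}^{\mathcal X}$; the corresponding complete smoothing is a disjoint union of circles in $\mathbb{R}\mathrm{P}^2$, each trivial (bounding a disk) or projective (not); each state has at most one projective circle. Let $\#0(s),\#1(s)$ be the numbers of $0$'s and $1$'s in $s$, $|s|_T,|s|_P$ the numbers of trivial and projective circles. Modules. $V=\langle 1,X\rangle$ is the free bigraded $\mathbb{Z}$-module with $\deg 1=(-2,0)$,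 $\deg X=(2,0)$; $\overline V=\langle\bar 1,\bar X\rangle$ with $\deg\bar1=(0,1)$, $\deg\bar X=(0,-1)$. For bigraded modules, $W\wedge W'=\bigoplus_{j=j_1+j_2,k=k_1+k_2}W_{j_1,k_1}\wedge W'_{j_2,k_2}$ (the tensor product of the pieces, with the convention that it is associative and reordering factors of a product $W_1\wedge\cdots\wedge W_n$ by a permutation $\sigma$ multiplies by $\mathrm{sign}(\sigma)$). The shift is $W\{l\}_{j,k}=W_{j-l,k}$. For a state $s$, enumerate its circles with the projective circle (if any) last, and set $C_s=(V_1\wedge\cdots\wedge V_r)\{\#0(s)-\#1(s)\}$ or $C_s=(V_1\wedge\cdots\wedge V_{r}\wedge\overline V_{r+1})\{\#0(s)-\#1(s)\}$, one factor $V$ per trivial circle and $\overline V$ for the projective circle. Put $C^i=\bigoplus_{\#0(s)-\#1(s)=i}C_s$. Partial differentials. Orient every circle of every state arbitrarily. An edge is $\alpha\in\{0,1,\star\}^{\mathcal X}$ with exactly one $\star$, at crossing $c$; $s_0=\alpha_{\star\to0}$, $s_1=\alpha_{\star\to1}$. Passing from $s_0$ to $s_1$ is a bifurcation of type $2\to1$ (two circles merge), $1\to2$ (one circle splits), or $1\to1$ (one circle becomes one circle; possible only because $\mathbb{R}\mathrm{P}^2$ is non-orientable); all other circles correspond bijectively. Position $c$ so that its two outgoing diagram arcs point northwest and northeast and incoming arcs come from southwest and southeast. A circle of a state near $c$ is locally consistent at $c$ if its orientation agrees with the diagram orientation of the northeast arc or disagrees with that of the southwest arc, and locally inconsistent if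 it disagrees with the northeast arc or agrees with the southwest arc. Define $d_\alpha:C_{s_0}\to C_{s_1}$ by $d_\alpha=P_\rho\circ(\varphi\wedge\mathcal I)\circ P_\sigma$, where: $P_\sigma$ permutes wedge factors of $C_{s_0}$ (with sign of the permutation) so that the factors of the circles involved in the bifurcation come first, and for type $2\to1$ the first factor is the left circle if $c$ is positive and the top circle if $c$ is negative; $\varphi=m$ for type $2\to1$, $\varphi=\Delta$ for type $1\to2$ (the first output factor being the top circle if $c$ is positive and the left circle if $c$ is negative), and $\varphi=0$ for type $1\to1$; $\mathcal I$ acts on each remaining factor by $1\mapsto1$, $X\mapsto\pm X$ (resp. $\bar1\mapsto\bar1$, $\bar X\mapsto\pm\bar X$), with $+$ iff the chosen orientations of the corresponding circles in $s_0$ and $s_1$ agree; $P_\rho$ reorders the result into the factor order of $C_{s_1}$. In the formulas for $m,\Delta$, write $X'=\epsilon X$, $\bar X'=\epsilon\bar X$, where $\epsilon=+1$ if the circle carrying that factor is locally consistent at $c$ and $-1$ otherwise (subscripts indicate factor position, unsubscripted is the single circle): $m:V\wedge V\to V$: $1\wedge1\mapsto1$, $1\wedge X'\mapsto X'$, $X'\wedge1\mapsto X'$, $X'\wedge X'\mapsto0$; $\Delta:V\to V\wedge V$: $1\mapsto 1_1\wedge X'_2+X'_1\wedge1_2$, $X'\mapsto X'_1\wedge X'_2$. $m:\overline V\wedge V\to\overline V$: $\bar1\wedge1\mapsto\bar1$, $\bar1\wedge X'\mapsto0$, $\bar X'\wedge1\mapsto\bar X'$, $\bar X'\wedge X'\mapsto0$;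 $\Delta:\overline V\to\overline V\wedge V$: $\bar1\mapsto\bar1_1\wedge X'_2$, $\bar X'\mapsto\bar X'_1\wedge X'_2$. $m:V\wedge\overline V\to\overline V$: $1\wedge\bar1\mapsto\bar1$, $1\wedge\bar X'\mapsto\bar X'$, $X'\wedge\bar1\mapsto0$, $X'\wedge\bar X'\mapsto0$; $\Delta:\overline V\to V\wedge\overline V$: $\bar1\mapsto X'_1\wedge\bar1_2$, $\bar X'\mapsto X'_1\wedge\bar X'_2$. The total differential is $d^{(i)}=\sum d_\alpha:C^i\to C^{i-2}$, summed over all edges $\alpha$ with $\#0(\alpha)-\#1(\alpha)=i-1$. The homology is $H_i(D)=\ker d^{(i)}/\operatorname{im}d^{(i+2)}$, a triply graded $\mathbb{Z}$-module (homological degree $i$ and the bigrading $(j,k)$). *)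

theory Defs
  imports Main
begin

text \<open>Each crossing is drawn (in the disk model of RP2) rotated so that its two outgoing
  diagram arcs point NW and NE and the incoming arcs come from SW and SE.  A half-edge is a
  pair (crossing, quadrant).  The quadrants NE, NW, SW, SE are in counterclockwise order
  with respect to the orientation of the disk.\<close>

datatype quad = NE | NW | SW | SE

fun ccw :: "quad \<Rightarrow> quad" where
  "ccw NE = NW" | "ccw NW = SW" | "ccw SW = SE" | "ccw SE = NE"

fun cw :: "quad \<Rightarrow> quad" where
  "cw NE = SE" | "cw NW = NE" | "cw SW = NW" | "cw SE = SW"

text \<open>vertical smoothing: arcs NW-SW and NE-SE; horizontal smoothing: arcs NW-NE and SW-SE\<close>
fun vflip :: "quad \<Rightarrow> quad" where
  "vflip NW = SW" | "vflip SW = NW" | "vflip NE = SE" | "vflip SE = NE"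

fun hflip :: "quad \<Rightarrow> quad" where
  "hflip NW = NE" | "hflip NE = NW" | "hflip SW = SE" | "hflip SE = SW"

definition is_out :: "quad \<Rightarrow> bool" where
  "is_out q \<longleftrightarrow> q = NE \<or> q = NW"

text \<open>A projective diagram:
  Xs    : the (finite) set of crossings;
  edg   : the diagram arcs, pairing half-edges (an involution);
  twist : True iff the arc crosses the boundary circle of the disk an odd number of times;
  ovr   : True iff the SW-to-NE strand is the over strand, i.e. iff the crossing is positive;
  nfree : number of crossingless components that are trivial circles;
  pfree : whether there is a crossingless component that is a projective circle.\<close>

record 'c pdiag =
  Xs :: "'c set"
  edg :: "'c \<times> quad \<Rightarrow> 'c \<times> quad"
  twist :: "'c \<times> quad \<Rightarrow> bool"
  ovr :: "'c \<Rightarrow> bool"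
  nfree :: nat
  pfree :: bool

definition halfs :: "('c, 'z) pdiag_scheme \<Rightarrow> ('c \<times> quad) set" where
  "halfs D = Xs D \<times> UNIV"

text \<open>Flags of the underlying 4-valent map (generalized map): a half-edge and a side of it
  (True = counterclockwise side).\<close>

fun tau_c :: "('c \<times> quad) \<times> bool \<Rightarrow> ('c \<times> quad) \<times> bool" where
  "tau_c ((c, q), \<sigma>) = (if \<sigma> then ((c, ccw q), False) else ((c, cw q), True))"

definition tau_e :: "('c, 'z) pdiag_scheme \<Rightarrow> ('c \<times> quad) \<times> bool \<Rightarrow> ('c \<times> quad) \<times> bool" where
  "tau_e D f = (edg D (fst f), if twist D (fst f) then snd f else \<not> snd f)"

definition face_rel :: "('c, 'z) pdiag_scheme \<Rightarrow> ((('c \<times> quad) \<times> bool) \<times> (('c \<times> quad) \<times> bool)) set" where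
  "face_rel D = (\<Union>f \<in> halfs D \<times> UNIV. {(f, tau_c f), (f, tau_e D f)})\<^sup>*"

definition comp_rel :: "('c, 'z) pdiag_scheme \<Rightarrow> ('c \<times> 'c) set" where
  "comp_rel D = {(c, fst (edg D (c, q))) | c q. c \<in> Xs D}\<^sup>*"

definition components :: "('c, 'z) pdiag_scheme \<Rightarrow> 'c set set" where
  "components D = Xs D // comp_rel D"

definition nfaces :: "('c, 'z) pdiag_scheme \<Rightarrow> 'c set \<Rightarrow> nat" where
  "nfaces D K = card (((K \<times> UNIV) \<times> UNIV) // face_rel D)"

text \<open>Well-formed projective diagram: arcs join an outgoing half-edge to an incoming one, and
  the 4-valent graph is embedded in RP2: every connected component (V vertices, E = 2V edges,
  F faces) has Euler characteristic F - V equal to 2 (sphere) or 1 (projective plane), and at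
  most one component (including a crossingless projective circle) is essential.\<close>

definition is_pdiag :: "('c, 'z) pdiag_scheme \<Rightarrow> bool" where
  "is_pdiag D \<longleftrightarrow>
     finite (Xs D) \<and>
     (\<forall>h \<in> halfs D. edg D h \<in> halfs D \<and> edg D (edg D h) = h \<and> edg D h \<noteq> h \<and>
        (is_out (snd h) \<longleftrightarrow> \<not> is_out (snd (edg D h))) \<and> twist D (edg D h) = twist D h) \<and>
     (\<forall>K \<in> components D. card K + 1 \<le> nfaces D K) \<and>
     card {K \<in> components D. nfaces D K = card K + 1} + (if pfree D then 1 else 0) \<le> (1::nat)"

text \<open>A state is s :: 'c => bool, False = type 0 (A-smoothing), True = type 1 (B-smoothing).\<close>

definition states :: "('c, 'z) pdiag_scheme \<Rightarrow> ('c \<Rightarrow> bool) set" where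
  "states D = {s. \<forall>c. s c \<longrightarrow> c \<in> Xs D}"

text \<open>Smoothing: the A-smoothing of a positive crossing (and the B-smoothing of a negative one)
  is vertical (arcs NW-SW, NE-SE), otherwise horizontal.\<close>
definition sm :: "('c, 'z) pdiag_scheme \<Rightarrow> ('c \<Rightarrow> bool) \<Rightarrow> 'c \<times> quad \<Rightarrow> 'c \<times> quad" where
  "sm D s h = (fst h, if ovr D (fst h) \<noteq> s (fst h) then vflip (snd h) else hflip (snd h))"

definition circ_rel :: "('c, 'z) pdiag_scheme \<Rightarrow> ('c \<Rightarrow> bool) \<Rightarrow> (('c \<times> quad) \<times> ('c \<times> quad)) set" where
  "circ_rel D s = ({(h, edg D h) | h. h \<in> halfs D} \<union> {(h, sm D s h) | h. h \<in> halfs D})\<^sup>*"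

datatype 'c circ = GC "('c \<times> quad) set" | FC nat | PC

definition circles :: "('c, 'z) pdiag_scheme \<Rightarrow> ('c \<Rightarrow> bool) \<Rightarrow> 'c circ set" where
  "circles D s = GC ` (halfs D // circ_rel D s) \<union> FC ` {..<nfree D} \<union> (if pfree D then {PC} else {})"

definition circ_of :: "('c, 'z) pdiag_scheme \<Rightarrow> ('c \<Rightarrow> bool) \<Rightarrow> 'c \<times> quad \<Rightarrow> 'c circ" where
  "circ_of D s h = GC (circ_rel D s `` {h})"

text \<open>A circle is projective iff it crosses the boundary of the disk an odd number of times.\<close>
definition is_proj :: "('c, 'z) pdiag_scheme \<Rightarrow> 'c circ \<Rightarrow> bool" where
  "is_proj D C = (case C of GC H \<Rightarrow> odd (card {h \<in> H. twist D h} div 2) | FC _ \<Rightarrow> False | PC \<Rightarrow> True)"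

text \<open>Basis of C_s: a labelling of circles, True = X (resp. X-bar), False = 1 (resp. 1-bar).\<close>
definition labelings :: "('c, 'z) pdiag_scheme \<Rightarrow> ('c \<Rightarrow> bool) \<Rightarrow> ('c circ \<Rightarrow> bool) set" where
  "labelings D s = {b. \<forall>C. b C \<longrightarrow> C \<in> circles D s}"

definition deg :: "('c, 'z) pdiag_scheme \<Rightarrow> ('c \<Rightarrow> bool) \<Rightarrow> int" where
  "deg D s = int (card {c \<in> Xs D. \<not> s c}) - int (card {c \<in> Xs D. s c})"

text \<open>ori s h = True iff the chosen orientation of the circle of state s through half-edge h
  traverses h towards its crossing; fori s C is the orientation of a crossingless circle.\<close>

definition admissible_ori :: "('c, 'z) pdiag_scheme \<Rightarrow> (('c \<Rightarrow> bool) \<Rightarrow> 'c \<times> quad \<Rightarrow> bool) \<Rightarrow> bool" where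
  "admissible_ori D ori \<longleftrightarrow> (\<forall>s \<in> states D. \<forall>h \<in> halfs D.
      ori s (edg D h) \<noteq> ori s h \<and> ori s (sm D s h) \<noteq> ori s h)"

definition admissible_ord :: "('c, 'z) pdiag_scheme \<Rightarrow> (('c \<Rightarrow> bool) \<Rightarrow> 'c circ list) \<Rightarrow> bool" where
  "admissible_ord D ordr \<longleftrightarrow> (\<forall>s \<in> states D. distinct (ordr s) \<and> set (ordr s) = circles D s \<and>
      (\<forall>C \<in> circles D s. is_proj D C \<longrightarrow> last (ordr s) = C))"

definition agree :: "(('c \<Rightarrow> bool) \<Rightarrow> 'c \<times> quad \<Rightarrow> bool) \<Rightarrow> (('c \<Rightarrow> bool) \<Rightarrow> 'c circ \<Rightarrow> bool)
    \<Rightarrow> ('c \<Rightarrow> bool) \<Rightarrow> ('c \<Rightarrow> bool) \<Rightarrow> 'c circ \<Rightarrow> bool" where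
  "agree ori fori s0 s1 C = (case C of GC H \<Rightarrow> (\<forall>h \<in> H. ori s0 h = ori s1 h) | _ \<Rightarrow> fori s0 C = fori s1 C)"

text \<open>epsilon: +1 iff the circle is locally consistent at c, i.e. it traverses the NE half-edge
  outwards (agrees with the diagram) or the SW half-edge outwards (disagrees with the diagram).\<close>
definition eps :: "(('c \<Rightarrow> bool) \<Rightarrow> 'c \<times> quad \<Rightarrow> bool) \<Rightarrow> ('c \<Rightarrow> bool) \<Rightarrow> 'c \<Rightarrow> 'c circ \<Rightarrow> int" where
  "eps ori s c C = (case C of
      GC H \<Rightarrow> (if ((c, NE) \<in> H \<and> \<not> ori s (c, NE)) \<or> ((c, SW) \<in> H \<and> \<not> ori s (c, SW)) then 1 else -1)
    | _ \<Rightarrow> 1)"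

definition pos :: "'a list \<Rightarrow> 'a \<Rightarrow> nat" where
  "pos ys a = (LEAST i. i < length ys \<and> ys ! i = a)"

definition perm_sign :: "'a list \<Rightarrow> 'a list \<Rightarrow> int" where
  "perm_sign xs ys = (-1) ^ card {(i, j). i < j \<and> j < length xs \<and> pos ys (xs ! j) < pos ys (xs ! i)}"

text \<open>inputs a, b (first, second factor), output m; eA, eB, eM the epsilons\<close>
definition m_VV :: "bool \<Rightarrow> bool \<Rightarrow> bool \<Rightarrow> int \<Rightarrow> int \<Rightarrow> int \<Rightarrow> int" where
  "m_VV a b m eA eB eM =
     (if \<not> a \<and> \<not> b then (if m then 0 else 1)
      else if \<not> a \<and> b then (if m then eB * eM else 0)
      else if a \<and> \<not> b then (if m then eA * eM else 0)
      else 0)"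

definition m_PV :: "bool \<Rightarrow> bool \<Rightarrow> bool \<Rightarrow> int \<Rightarrow> int \<Rightarrow> int \<Rightarrow> int" where
  "m_PV a b m eA eB eM =
     (if \<not> a \<and> \<not> b then (if m then 0 else 1)
      else if a \<and> \<not> b then (if m then eA * eM else 0)
      else 0)"

definition m_VP :: "bool \<Rightarrow> bool \<Rightarrow> bool \<Rightarrow> int \<Rightarrow> int \<Rightarrow> int \<Rightarrow> int" where
  "m_VP a b m eA eB eM =
     (if \<not> a \<and> \<not> b then (if m then 0 else 1)
      else if \<not> a \<and> b then (if m then eB * eM else 0)
      else 0)"

text \<open>input x (epsilon eC), outputs a, b (first, second factor)\<close>
definition D_VV :: "bool \<Rightarrow> bool \<Rightarrow> bool \<Rightarrow> int \<Rightarrow> int \<Rightarrow> int \<Rightarrow> int" where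
  "D_VV x a b eC eA eB =
     (if \<not> x then (if \<not> a \<and> b then eB else if a \<and> \<not> b then eA else 0)
      else (if a \<and> b then eC * eA * eB else 0))"

definition D_PV :: "bool \<Rightarrow> bool \<Rightarrow> bool \<Rightarrow> int \<Rightarrow> int \<Rightarrow> int \<Rightarrow> int" where
  "D_PV x a b eC eA eB =
     (if \<not> x then (if \<not> a \<and> b then eB else 0)
      else (if a \<and> b then eC * eA * eB else 0))"

definition D_VP :: "bool \<Rightarrow> bool \<Rightarrow> bool \<Rightarrow> int \<Rightarrow> int \<Rightarrow> int \<Rightarrow> int" where
  "D_VP x a b eC eA eB =
     (if \<not> x then (if a \<and> \<not> b then eA else 0)
      else (if a \<and> b then eC * eA * eB else 0))"

text \<open>Matrix coefficient of d_alpha (alpha = the edge s0 -> s0(c:=1)) from basis element b0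
  of C_{s0} to basis element b1 of C_{s1}.  In both s0 and s1 the circle through the NW
  half-edge of c is the left (resp. top) circle required as first factor.\<close>
definition coef :: "('c, 'z) pdiag_scheme \<Rightarrow> (('c \<Rightarrow> bool) \<Rightarrow> 'c \<times> quad \<Rightarrow> bool)
    \<Rightarrow> (('c \<Rightarrow> bool) \<Rightarrow> 'c circ \<Rightarrow> bool) \<Rightarrow> (('c \<Rightarrow> bool) \<Rightarrow> 'c circ list)
    \<Rightarrow> 'c \<Rightarrow> ('c \<Rightarrow> bool) \<Rightarrow> ('c circ \<Rightarrow> bool) \<Rightarrow> ('c circ \<Rightarrow> bool) \<Rightarrow> int" where
  "coef D ori fori ordr c s0 b0 b1 =
    (let s1 = s0(c := True);
         A0 = circ_of D s0 (c, NW); B0 = circ_of D s0 (c, SE);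
         A1 = circ_of D s1 (c, NW); B1 = circ_of D s1 (c, SE);
         rest = filter (\<lambda>C. C \<noteq> A0 \<and> C \<noteq> B0) (ordr s0);
         Isign = (\<Prod>C \<in> set rest. if b0 C \<and> \<not> agree ori fori s0 s1 C then -1 else 1 :: int)
     in if \<not> (\<forall>C \<in> set rest. b1 C = b0 C) then 0
        else if A0 \<noteq> B0 then
          perm_sign (ordr s0) (A0 # B0 # rest) * perm_sign (A1 # rest) (ordr s1) * Isign *
          (if is_proj D A0 then m_PV else if is_proj D B0 then m_VP else m_VV)
             (b0 A0) (b0 B0) (b1 A1) (eps ori s0 c A0) (eps ori s0 c B0) (eps ori s1 c A1)
        else if A1 \<noteq> B1 then
          perm_sign (ordr s0) (A0 # rest) * perm_sign (A1 # B1 # rest) (ordr s1) * Isign *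
          (if is_proj D A1 then D_PV else if is_proj D B1 then D_VP else D_VV)
             (b0 A0) (b1 A1) (b1 B1) (eps ori s0 c A0) (eps ori s1 c A1) (eps ori s1 c B1)
        else 0)"

type_synonym 'c chain = "('c \<Rightarrow> bool) \<times> ('c circ \<Rightarrow> bool) \<Rightarrow> int"

definition dtot :: "('c, 'z) pdiag_scheme \<Rightarrow> (('c \<Rightarrow> bool) \<Rightarrow> 'c \<times> quad \<Rightarrow> bool)
    \<Rightarrow> (('c \<Rightarrow> bool) \<Rightarrow> 'c circ \<Rightarrow> bool) \<Rightarrow> (('c \<Rightarrow> bool) \<Rightarrow> 'c circ list) \<Rightarrow> 'c chain \<Rightarrow> 'c chain" where
  "dtot D ori fori ordr x = (\<lambda>(s1, b1).
     if s1 \<in> states D \<and> b1 \<in> labelings D s1 then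
       (\<Sum>c \<in> {c \<in> Xs D. s1 c}. \<Sum>b0 \<in> labelings D (s1(c := False)).
          x (s1(c := False), b0) * coef D ori fori ordr c (s1(c := False)) b0 b1)
     else 0)"

definition chains :: "('c, 'z) pdiag_scheme \<Rightarrow> int \<Rightarrow> 'c chain set" where
  "chains D i = {x. \<forall>s b. x (s, b) \<noteq> 0 \<longrightarrow> s \<in> states D \<and> b \<in> labelings D s \<and> deg D s = i}"

definition dd :: "('c, 'z) pdiag_scheme \<Rightarrow> (('c \<Rightarrow> bool) \<Rightarrow> 'c \<times> quad \<Rightarrow> bool)
    \<Rightarrow> (('c \<Rightarrow> bool) \<Rightarrow> 'c circ \<Rightarrow> bool) \<Rightarrow> (('c \<Rightarrow> bool) \<Rightarrow> 'c circ list) \<Rightarrow> int \<Rightarrow> 'c chain \<Rightarrow> 'c chain" where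
  "dd D ori fori ordr i x = dtot D ori fori ordr (\<lambda>(s, b). if deg D s = i then x (s, b) else 0)"

end

theory Submission
  imports Defs
begin

text \<open>
  Projective circles are eliminated first: the coefficients preserving the label of the projective
  circle are the degree zero part of those of the complex in which every circle carries V, and the
  latter never turn an X on that circle into a 1.  In the all-V complex let X_h, for a half-edge h,
  be X on the circle through h with the sign of its orientation at h.  The partial differentials
  commute with multiplication by every X_h, so it suffices to compare the two composites around a
  face on the element 1.  There a merge acts as a sign, a split as a sign times X_NW + X_SE at the
  crossing, and a one-to-one bifurcation as 0.  The orderings of circles cancel around the face up
  to the circles meeting its two crossings, and these depend only on the perfect matching of the
  eight half-edges at the two crossings given by the arcs of the smoothing outside them.  This
  leaves one sign identity for each of the 105 matchings.
\<close>

section \<open>Signs of reorderings\<close>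

text \<open>Projective circles have to be removed because linearity over the X_h fails for them:
  merging a projective with a trivial circle sends 1 \<and> X to 0, although it sends 1 \<and> 1 to
  1. The chosen orientations enter d twice, through epsilon and through the signs on uninvolved
  circles; putting the sign of the orientation at h into X_h turns both into the same linearity, so
  orientations never have to be normalized. The value on 1 decides a face because the X_h generate
  everything from 1, and because a reordering moves whole factors, so that its sign ignores their
  labels. The remaining obstacle is the one-to-one bifurcation: a split followed by a merge may
  stand opposite two of them and must then vanish alone. It does, since X_NW and X_SE are opposite
  when one circle runs through these half-edges in opposite directions.\<close>

lemma pos_props:
  assumes "a \<in> set xs"
  shows pos_less: "pos xs a < length xs" and nth_pos: "xs ! pos xs a = a"
proof -
  have "\<exists>i. i < length xs \<and> xs ! i = a" using assms by (simp add: in_set_conv_nth)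
  from LeastI_ex[OF this] show "pos xs a < length xs" "xs ! pos xs a = a"
    unfolding pos_def by auto
qed

lemma pos_nth: "distinct xs \<Longrightarrow> i < length xs \<Longrightarrow> pos xs (xs ! i) = i"
  by (metis nth_eq_iff_index_eq nth_mem nth_pos pos_less)

lemma pos_inj: "a \<in> set xs \<Longrightarrow> b \<in> set xs \<Longrightarrow> pos xs a = pos xs b \<longleftrightarrow> a = b"
  by (metis nth_pos)

lemma pos_append:
  assumes "distinct (xs @ ys)" "a \<in> set (xs @ ys)"
  shows "pos (xs @ ys) a = (if a \<in> set xs then pos xs a else length xs + pos ys a)"
proof (cases "a \<in> set xs")
  case True
  have "(xs @ ys) ! pos xs a = a" "pos xs a < length (xs @ ys)"
    using pos_less[OF True] nth_pos[OF True] by (auto simp: nth_append)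
  then show ?thesis using pos_nth[OF assms(1), of "pos xs a"] True by auto
next
  case False
  then have a: "a \<in> set ys" using assms(2) by auto
  have "(xs @ ys) ! (length xs + pos ys a) = a" "length xs + pos ys a < length (xs @ ys)"
    using pos_less[OF a] nth_pos[OF a] by (auto simp: nth_append)
  then show ?thesis using pos_nth[OF assms(1), of "length xs + pos ys a"] False by auto
qed

text \<open>Unordered pairs of elements replace the index pairs of \<open>perm_sign\<close>: they
  make sense for all orderings of one set at once, so that successive changes of order combine by
  symmetric difference.\<close>

definition discordant :: "'a list \<Rightarrow> 'a list \<Rightarrow> 'a set set" where
  "discordant xs ys = {{a, b} | a b. a \<in> set xs \<and> b \<in> set xs \<and> pos xs a < pos xs b \<and> pos ys b < pos ys a}"

lemma discordant_subset: "discordant xs ys \<subseteq> Pow (set xs)"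
  unfolding discordant_def by auto

lemma finite_discordant: "finite (discordant xs ys)"
  using discordant_subset finite_subset by (metis List.finite_set finite_Pow_iff)

lemma perm_sign_discordant:
  assumes "distinct xs"
  shows "perm_sign xs ys = (-1) ^ card (discordant xs ys)"
proof -
  let ?I = "{(i, j). i < j \<and> j < length xs \<and> pos ys (xs ! j) < pos ys (xs ! i)}"
  have "bij_betw (\<lambda>(i, j). {xs ! i, xs ! j}) ?I (discordant xs ys)"
  proof (rule bij_betw_imageI)
    show "inj_on (\<lambda>(i, j). {xs ! i, xs ! j}) ?I"
      using assms by (auto simp: inj_on_def doubleton_eq_iff nth_eq_iff_index_eq)
    show "(\<lambda>(i, j). {xs ! i, xs ! j}) ` ?I = discordant xs ys" (is "?L = _")
    proof
      show "?L \<subseteq> discordant xs ys"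
        unfolding discordant_def using assms by (force simp: pos_nth)
      show "discordant xs ys \<subseteq> ?L"
      proof
        fix P assume "P \<in> discordant xs ys"
        then obtain a b where P: "P = {a, b}" "a \<in> set xs" "b \<in> set xs"
          "pos xs a < pos xs b" "pos ys b < pos ys a" unfolding discordant_def by auto
        then show "P \<in> ?L"
          by (intro image_eqI[of _ _ "(pos xs a, pos xs b)"]) (auto simp: nth_pos pos_less)
      qed
    qed
  qed
  then show ?thesis unfolding perm_sign_def by (simp add: bij_betw_same_card)
qed

text \<open>A pair is discordant between \<open>xs\<close> and \<open>zs\<close> iff it is
  discordant in exactly one of the two steps, and a symmetric difference has the parity of the sum
  of the two sizes.\<close>

lemma perm_sign_mult:
  assumes "distinct xs" "distinct ys" "distinct zs" "set xs = set ys" "set ys = set zs"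
  shows "perm_sign xs ys * perm_sign ys zs = perm_sign xs zs"
proof -
  let ?A = "discordant xs ys" and ?B = "discordant ys zs"
  have eq: "discordant xs zs = (?A - ?B) \<union> (?B - ?A)" (is "_ = ?R")
  proof (intro set_eqI)
    fix P
    have mem: "{a, b} \<in> discordant us vs \<longleftrightarrow> (pos us a < pos us b \<longleftrightarrow> pos vs b < pos vs a)"
      if "a \<in> set xs" "b \<in> set xs" "a \<noteq> b" "set us = set xs" "set vs = set xs" for a b us vs
    proof -
      have "pos us a \<noteq> pos us b" "pos vs a \<noteq> pos vs b" using that by (auto simp: pos_inj)
      then show ?thesis unfolding discordant_def using that
        by (auto simp: doubleton_eq_iff linorder_neq_iff)
    qed
    show "P \<in> discordant xs zs \<longleftrightarrow> P \<in> ?R"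
    proof (cases "\<exists>a b. P = {a, b} \<and> a \<in> set xs \<and> b \<in> set xs \<and> a \<noteq> b")
      case True
      then obtain a b where P: "P = {a, b}" "a \<in> set xs" "b \<in> set xs" "a \<noteq> b" by auto
      have "pos us a \<noteq> pos us b" if "set us = set xs" for us using that P by (auto simp: pos_inj)
      then show ?thesis using P assms by (auto simp: mem linorder_neq_iff)
    next
      case False
      then have "P \<notin> discordant us vs" if "set us = set xs" for us vs
        using that unfolding discordant_def by fastforce
      then show ?thesis using assms by auto
    qed
  qed
  have "card (discordant xs zs) + 2 * card (?A \<inter> ?B) = card ?A + card ?B"
  proof -
    have "card (discordant xs zs) = card (?A - ?B) + card (?B - ?A)"
      unfolding eq by (rule card_Un_disjoint) (auto simp: finite_discordant)
    moreover have "card ?A = card (?A - ?B) + card (?A \<inter> ?B)"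
      by (subst card_Un_disjoint[symmetric]) (auto simp: finite_discordant intro: arg_cong[where f=card])
    moreover have "card ?B = card (?B - ?A) + card (?A \<inter> ?B)"
      by (subst card_Un_disjoint[symmetric]) (auto simp: finite_discordant intro: arg_cong[where f=card])
    ultimately show ?thesis by simp
  qed
  then have "(-1::int) ^ (card (discordant xs zs) + 2 * card (?A \<inter> ?B)) = (-1) ^ (card ?A + card ?B)"
    by simp
  then show ?thesis using assms by (simp add: perm_sign_discordant power_add power_mult)
qed

lemma perm_sign_refl: "distinct xs \<Longrightarrow> perm_sign xs xs = 1"
proof -
  assume "distinct xs"
  have "discordant xs xs = {}" unfolding discordant_def by auto
  then show ?thesis using \<open>distinct xs\<close> by (simp add: perm_sign_discordant)
qed

lemma perm_sign_square: "perm_sign xs ys * perm_sign xs ys = 1"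
  unfolding perm_sign_def by (simp flip: power_mult_distrib)

lemma perm_sign_sym:
  assumes "distinct xs" "distinct ys" "set xs = set ys"
  shows "perm_sign xs ys = perm_sign ys xs"
proof -
  have "perm_sign xs ys * perm_sign ys xs = 1"
    using perm_sign_mult[OF assms(1,2,1,3) assms(3)[symmetric]] perm_sign_refl[OF assms(1)] by simp
  then show ?thesis by (auto simp: zmult_eq_1_iff)
qed

lemma perm_sign_append_left:
  assumes "distinct (zs @ xs)" "distinct (zs @ ys)" "set xs = set ys"
  shows "perm_sign (zs @ xs) (zs @ ys) = perm_sign xs ys"
proof -
  have "discordant (zs @ xs) (zs @ ys) = discordant xs ys"
  proof -
    have "a \<in> set xs \<and> b \<in> set xs"
      if "a \<in> set (zs @ xs)" "b \<in> set (zs @ xs)" "pos (zs @ xs) a < pos (zs @ xs) b"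
        "pos (zs @ ys) b < pos (zs @ ys) a" for a b
    proof -
      have "a \<in> set (zs @ ys)" "b \<in> set (zs @ ys)" using that assms(3) by auto
      then show ?thesis using that assms pos_less[of a zs] pos_less[of b zs]
        by (auto simp: pos_append split: if_splits)
    qed
    moreover have "pos (zs @ xs) a = length zs + pos xs a" "pos (zs @ ys) a = length zs + pos ys a"
      if "a \<in> set xs" for a using that assms by (subst pos_append; auto)+
    ultimately show ?thesis unfolding discordant_def by (auto; metis nat_add_left_cancel_less)
  qed
  then show ?thesis using assms by (simp add: perm_sign_discordant)
qed

lemma perm_sign_append_right:
  assumes "distinct (xs @ zs)" "distinct (ys @ zs)" "set xs = set ys"
  shows "perm_sign (xs @ zs) (ys @ zs) = perm_sign xs ys"
proof -
  have len: "length xs = length ys" using assms by (metis distinct_append distinct_card)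
  have "discordant (xs @ zs) (ys @ zs) = discordant xs ys"
  proof -
    have "a \<in> set xs \<and> b \<in> set xs"
      if "a \<in> set (xs @ zs)" "b \<in> set (xs @ zs)" "pos (xs @ zs) a < pos (xs @ zs) b"
        "pos (ys @ zs) b < pos (ys @ zs) a" for a b
    proof -
      have "a \<in> set (ys @ zs)" "b \<in> set (ys @ zs)" using that assms(3) by auto
      then show ?thesis using that assms len pos_less[of a xs] pos_less[of b xs]
          pos_less[of a ys] pos_less[of b ys]
        by (auto simp: pos_append split: if_splits)
    qed
    moreover have "pos (xs @ zs) a = pos xs a" "pos (ys @ zs) a = pos ys a"
      if "a \<in> set xs" for a using that assms by (subst pos_append; auto)+
    ultimately show ?thesis unfolding discordant_def by (auto; metis)
  qed
  then show ?thesis using assms by (simp add: perm_sign_discordant)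
qed

lemma pos_map:
  assumes "inj_on f (set xs)" "a \<in> set xs" "distinct xs"
  shows "pos (map f xs) (f a) = pos xs a"
  using pos_nth[of "map f xs" "pos xs a"] assms
  by (simp add: distinct_map pos_less nth_pos)

lemma perm_sign_map:
  assumes "inj_on f (set xs)" "distinct ys" "set xs = set ys"
  shows "perm_sign (map f xs) (map f ys) = perm_sign xs ys"
proof -
  have "{(i, j). i < j \<and> j < length (map f xs) \<and>
      pos (map f ys) (map f xs ! j) < pos (map f ys) (map f xs ! i)} =
    {(i, j). i < j \<and> j < length xs \<and> pos ys (xs ! j) < pos ys (xs ! i)}"
  proof -
    have "pos (map f ys) (f (xs ! j)) = pos ys (xs ! j)" if "j < length xs" for j
    proof (rule pos_map)
      show "inj_on f (set ys)" using assms by simp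
      show "xs ! j \<in> set ys" using that nth_mem assms(3) by blast
    qed fact
    then show ?thesis by auto
  qed
  then show ?thesis unfolding perm_sign_def by simp
qed

lemma perm_sign_swap:
  assumes "distinct (x # y # zs)"
  shows "perm_sign (x # y # zs) (y # x # zs) = -1"
proof -
  have "{(i, j). i < j \<and> j < length [x, y] \<and> pos [y, x] ([x, y] ! j) < pos [y, x] ([x, y] ! i)} = {(0, 1)}"
  proof -
    have "pos [y, x] y = 0" "pos [y, x] x = 1"
      using pos_nth[of "[y, x]" 0] pos_nth[of "[y, x]" 1] assms by auto
    then show ?thesis by (auto simp: less_Suc_eq)
  qed
  then have "perm_sign [x, y] [y, x] = -1" unfolding perm_sign_def by simp
  then show ?thesis using perm_sign_append_right[of "[x, y]" zs "[y, x]"] assms by auto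
qed

section \<open>An executable parity of reorderings\<close>

fun even_index :: "'a \<Rightarrow> 'a list \<Rightarrow> bool" where
  "even_index x [] = True"
| "even_index x (y # ys) = (if x = y then True else \<not> even_index x ys)"

text \<open>Bringing \<open>x\<close> to the front of \<open>ys\<close> costs one transposition per
  element before it, after which the tails are compared. Booleans stand for signs and equality for
  their product; this form can be evaluated on concrete lists.\<close>

fun even_perm :: "'a list \<Rightarrow> 'a list \<Rightarrow> bool" where
  "even_perm [] ys = True"
| "even_perm (x # xs) ys = (even_index x ys = even_perm xs (remove1 x ys))"

lemma perm_sign_move:
  assumes "distinct ys" "x \<in> set ys"
  shows "perm_sign (x # remove1 x ys) ys = (if even_index x ys then 1 else -1)"
  using assms
proof (induction ys)
  case (Cons y ys)
  show ?case
  proof (cases "x = y")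
    case True
    then show ?thesis using Cons.prems by (simp add: perm_sign_refl)
  next
    case False
    have x: "x \<in> set ys" using Cons.prems False by auto
    have st: "set (remove1 x ys) = set ys - {x}" using Cons.prems by simp
    have "perm_sign (x # y # remove1 x ys) (y # ys) =
        perm_sign (x # y # remove1 x ys) (y # x # remove1 x ys) * perm_sign (y # x # remove1 x ys) (y # ys)"
      using Cons.prems False st x by (subst perm_sign_mult) (auto simp: insert_commute)
    also have "perm_sign (x # y # remove1 x ys) (y # x # remove1 x ys) = -1"
      using Cons.prems False st by (intro perm_sign_swap) auto
    also have "perm_sign (y # x # remove1 x ys) (y # ys) = perm_sign (x # remove1 x ys) ys"
      using perm_sign_append_left[of "[y]" "x # remove1 x ys" ys] Cons.prems False st x
      by (auto simp: insert_absorb)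
    finally show ?thesis using Cons x False by auto
  qed
qed simp

lemma perm_sign_even_perm:
  assumes "distinct xs" "distinct ys" "set xs = set ys"
  shows "perm_sign xs ys = (if even_perm xs ys then 1 else -1)"
  using assms
proof (induction xs arbitrary: ys)
  case Nil
  then show ?case by (simp add: perm_sign_refl)
next
  case (Cons x xs)
  let ?zs = "remove1 x ys"
  have x: "x \<in> set ys" and st: "set ?zs = set ys - {x}" using Cons.prems by auto
  have s: "set xs = set ?zs" using Cons.prems st by auto
  have "perm_sign (x # xs) ys = perm_sign (x # xs) (x # ?zs) * perm_sign (x # ?zs) ys"
    using Cons.prems s st x by (subst perm_sign_mult) (auto simp: insert_absorb)
  also have "perm_sign (x # xs) (x # ?zs) = perm_sign xs ?zs"
    using perm_sign_append_left[of "[x]" xs ?zs] Cons.prems s by auto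
  also have "\<dots> = (if even_perm xs ?zs then 1 else -1)" using Cons s by auto
  also have "perm_sign (x # ?zs) ys = (if even_index x ys then 1 else -1)"
    by (rule perm_sign_move[OF Cons.prems(2) x])
  finally show ?case by auto
qed

section \<open>The local check over all matchings\<close>

text \<open>The endpoints (x, q) are the quadrants q of two crossings, named False and True.  A table
  assigns to each endpoint a representative of its circle, and whether the circle has the same
  direction (towards the crossing or away from it) at both.\<close>

type_synonym endpt = "bool \<times> quad"
type_synonym table = "(endpt \<times> (endpt \<times> bool)) list"

definition endpts :: "endpt list" where
  "endpts = [(False, NW), (False, SE), (False, NE), (False, SW), (True, NW), (True, SE), (True, NE), (True, SW)]"

fun smooth_endpt :: "bool \<Rightarrow> bool \<Rightarrow> endpt \<Rightarrow> endpt" where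
  "smooth_endpt tc td (x, q) = (x, if (if x then td else tc) then hflip q else vflip q)"

text \<open>The number is half the length of the list. Each pair is stored in both directions, so
  that \<open>look\<close> acts as an involution. Eight endpoints give 7 * 5 * 3 * 1 = 105
  matchings.\<close>

fun matchings :: "nat \<Rightarrow> 'a list \<Rightarrow> ('a \<times> 'a) list list" where
  "matchings (Suc n) (x # xs) =
     concat (map (\<lambda>y. map (\<lambda>m. (x, y) # (y, x) # m) (matchings n (remove1 y xs))) xs)"
| "matchings _ _ = [[]]"

fun look :: "('a \<times> 'b) list \<Rightarrow> 'a \<Rightarrow> 'b" where
  "look ((x, y) # m) p = (if x = p then y else look m p)"
| "look [] p = undefined"

fun lmem :: "'a \<Rightarrow> ('a \<times> 'b) list \<Rightarrow> bool" where
  "lmem p [] = False"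
| "lmem p ((x, y) # m) = (if x = p then True else lmem p m)"

text \<open>One round crosses a smoothing arc and then an outside arc. The direction relative to the
  crossing flips along each, so every round starts with the direction of \<open>p\<close> again,
  recorded as \<open>True\<close>.\<close>

fun trace :: "(endpt \<times> endpt) list \<Rightarrow> bool \<Rightarrow> bool \<Rightarrow> nat \<Rightarrow> endpt \<Rightarrow> (endpt \<times> bool) list" where
  "trace m tc td 0 p = []"
| "trace m tc td (Suc n) p = (p, True) # (smooth_endpt tc td p, False) # trace m tc td n (look m (smooth_endpt tc td p))"

text \<open>The choice follows the fixed order of \<open>endpts\<close>, so it depends only on which
  endpoints lie on the circle: a circle untouched by a bifurcation keeps its name.\<close>

fun leader :: "endpt list \<Rightarrow> (endpt \<times> bool) list \<Rightarrow> endpt \<times> bool" where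
  "leader (q # qs) tr = (if lmem q tr then (q, look tr q) else leader qs tr)"
| "leader [] tr = undefined"

definition table :: "(endpt \<times> endpt) list \<Rightarrow> bool \<Rightarrow> bool \<Rightarrow> table" where
  "table m tc td = map (\<lambda>p. (p, leader endpts (trace m tc td 4 p))) endpts"

definition rep :: "table \<Rightarrow> endpt \<Rightarrow> endpt" where
  "rep T p = fst (look T p)"

definition rep_sign :: "table \<Rightarrow> endpt \<Rightarrow> bool" where
  "rep_sign T p = snd (look T p)"

definition reps :: "table \<Rightarrow> endpt list" where
  "reps T = filter (\<lambda>p. rep T p = p) endpts"

text \<open>Four rounds of the trace exhaust every circle; this is part of the check rather than a lemma.\<close>

definition closed_table :: "(endpt \<times> endpt) list \<Rightarrow> bool \<Rightarrow> bool \<Rightarrow> table \<Rightarrow> bool" where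
  "closed_table m tc td T = list_all (\<lambda>p. rep T (smooth_endpt tc td p) = rep T p \<and> rep T (look m p) = rep T p) endpts"

datatype kind = Merge bool | Split bool | One_One

definition edge_kind_aux :: "endpt \<Rightarrow> endpt \<Rightarrow> endpt \<Rightarrow> endpt \<Rightarrow> endpt list \<Rightarrow> endpt list \<Rightarrow> endpt list \<Rightarrow> kind" where
  "edge_kind_aux a0 b0 a1 b1 R0 R1 r =
     (if a0 \<noteq> b0 then Merge (even_perm R0 (a0 # b0 # r) = even_perm (a1 # r) R1)
      else if a1 \<noteq> b1 then Split (even_perm R0 (a0 # r) = even_perm (a1 # b1 # r) R1)
      else One_One)"

definition rest_reps :: "bool \<Rightarrow> table \<Rightarrow> endpt list" where
  "rest_reps x T = filter (\<lambda>p. p \<noteq> rep T (x, NW) \<and> p \<noteq> rep T (x, SE)) (reps T)"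

definition edge_kind :: "bool \<Rightarrow> table \<Rightarrow> table \<Rightarrow> kind" where
  "edge_kind x T0 T1 = edge_kind_aux (rep T0 (x, NW)) (rep T0 (x, SE)) (rep T1 (x, NW)) (rep T1 (x, SE))
     (reps T0) (reps T1) (rest_reps x T0)"

text \<open>A circle that avoids crossing \<open>x\<close> has the same leader in both tables, which
  is what lets \<open>edge_kind\<close> use one list of uninvolved circles for source and target.
  The check confirms this for the lists at hand.\<close>

definition lists_ok :: "bool \<Rightarrow> table \<Rightarrow> table \<Rightarrow> bool" where
  "lists_ok x T0 T1 \<longleftrightarrow> set (rep T1 (x, NW) # rep T1 (x, SE) # rest_reps x T0) = set (reps T1)"

text \<open>The number is fuel, one unit per cancelling pair. At most four terms occur, so the value
  4 in \<open>face_ok\<close> is ample.\<close>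

fun cancel :: "nat \<Rightarrow> (endpt \<times> bool) list \<Rightarrow> bool" where
  "cancel n [] = True"
| "cancel 0 (t # ts) = False"
| "cancel (Suc n) ((r, s) # ts) = (if (r, \<not> s) \<in> set ts then cancel n (remove1 (r, \<not> s) ts) else False)"

definition split_terms :: "bool \<Rightarrow> bool \<Rightarrow> table \<Rightarrow> (endpt \<times> bool) list" where
  "split_terms x s T = map (\<lambda>q. (rep T (x, q), rep_sign T (x, q) = s)) [NW, SE]"

text \<open>The composite of a merge and a split sends 1 to plus or minus X_NW + X_SE at the splitting
  crossing; x is the crossing of the first edge.\<close>

fun mixed_terms :: "table \<Rightarrow> bool \<Rightarrow> kind \<Rightarrow> kind \<Rightarrow> (endpt \<times> bool) list" where
  "mixed_terms T x (Split s) (Merge s') = split_terms x (s = s') T"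
| "mixed_terms T x (Merge s) (Split s') = split_terms (\<not> x) (s = s') T"
| "mixed_terms T x _ _ = []"

fun pure_sign :: "kind \<Rightarrow> kind \<Rightarrow> (bool \<times> bool) option" where
  "pure_sign (Merge s) (Merge s') = Some (False, s = s')"
| "pure_sign (Split s) (Split s') = Some (True, s = s')"
| "pure_sign _ _ = None"

text \<open>Two merges, or two splits, send 1 to a sign times an element that does not depend on the
  order of the crossings, so only signs are compared. Otherwise the terms have to cancel; a path
  through a one-to-one bifurcation gives the empty list, and then the terms of the other path must
  cancel each other.\<close>

definition face_ok :: "table \<Rightarrow> kind \<Rightarrow> kind \<Rightarrow> kind \<Rightarrow> kind \<Rightarrow> bool" where
  "face_ok T e1 e2 e3 e4 = (case pure_sign e1 e2 of
      Some (k, b) \<Rightarrow> (case pure_sign e3 e4 of Some (k', b') \<Rightarrow> k = k' \<and> b = (\<not> b') | None \<Rightarrow> False)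
    | None \<Rightarrow> (case pure_sign e3 e4 of Some _ \<Rightarrow> False
        | None \<Rightarrow> cancel 4 (mixed_terms T False e1 e2 @ mixed_terms T True e3 e4)))"

definition tables_ok :: "(endpt \<times> endpt) list \<Rightarrow> table \<Rightarrow> table \<Rightarrow> table \<Rightarrow> table \<Rightarrow> bool" where
  "tables_ok m T00 T10 T01 T11 \<longleftrightarrow>
     closed_table m False False T00 \<and> closed_table m True False T10 \<and>
     closed_table m False True T01 \<and> closed_table m True True T11 \<and>
     lists_ok False T00 T10 \<and> lists_ok True T10 T11 \<and> lists_ok True T00 T01 \<and> lists_ok False T01 T11 \<and>
     face_ok T11 (edge_kind False T00 T10) (edge_kind True T10 T11) (edge_kind True T00 T01) (edge_kind False T01 T11)"

definition matching_ok :: "(endpt \<times> endpt) list \<Rightarrow> bool" where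
  "matching_ok m = tables_ok m (table m False False) (table m True False) (table m False True) (table m True True)"

section \<open>Completeness of the matchings and soundness of the tables\<close>

lemma set_endpts: "set endpts = UNIV"
proof -
  have "(x, q) \<in> set endpts" for x q by (cases x; cases q) (simp_all add: endpts_def)
  then show ?thesis by auto
qed

lemma distinct_endpts: "distinct endpts" by (simp add: endpts_def)

lemma matchings_complete:
  assumes "distinct xs" "length xs = 2 * n"
    and "\<And>p. p \<in> set xs \<Longrightarrow> f p \<in> set xs \<and> f p \<noteq> p \<and> f (f p) = p"
  shows "\<exists>m \<in> set (matchings n xs). \<forall>p \<in> set xs. look m p = f p"
  using assms
proof (induction n arbitrary: xs)
  case (Suc n)
  then obtain x ys where xs: "xs = x # ys" by (cases xs) auto
  let ?y = "f x"
  have y: "?y \<in> set ys" "f ?y = x" "?y \<noteq> x" using Suc.prems(3)[of x] xs by auto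
  let ?zs = "remove1 ?y ys"
  have set_zs: "set ?zs = set ys - {?y}" using Suc.prems xs by simp
  have "\<exists>m \<in> set (matchings n ?zs). \<forall>p \<in> set ?zs. look m p = f p"
  proof (rule Suc.IH)
    show "distinct ?zs" using Suc.prems xs by simp
    show "length ?zs = 2 * n" using Suc.prems xs y by (simp add: length_remove1)
    fix p assume p: "p \<in> set ?zs"
    then have "p \<in> set xs" "p \<noteq> x" "p \<noteq> ?y" using Suc.prems(1) xs set_zs by auto
    moreover from this have "f p \<in> set xs" "f p \<noteq> p" "f (f p) = p" using Suc.prems(3) by blast+
    moreover from this have "f p \<noteq> x" "f p \<noteq> ?y" using \<open>p \<noteq> x\<close> \<open>p \<noteq> ?y\<close> y(2) by auto
    ultimately show "f p \<in> set ?zs \<and> f p \<noteq> p \<and> f (f p) = p" using set_zs xs by auto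
  qed
  then obtain m where m: "m \<in> set (matchings n ?zs)" "\<forall>p \<in> set ?zs. look m p = f p" by auto
  then show ?case
    using y set_zs xs by (intro bexI[of _ "(x, ?y) # (?y, x) # m"]) auto
qed simp

lemma look_mem: "lmem q tr \<Longrightarrow> (q, look tr q) \<in> set tr"
  by (induction tr) (auto split: if_splits)

lemma leader_mem:
  assumes "\<exists>q \<in> set qs. lmem q tr"
  shows "leader qs tr \<in> set tr"
  using assms by (induction qs) (auto simp: look_mem)

lemma look_map: "p \<in> set ps \<Longrightarrow> look (map (\<lambda>p. (p, g p)) ps) p = g p"
  by (induction ps) auto

text \<open>\<open>f\<close> stands for the actual circle through an endpoint and
  \<open>orient\<close> for its direction there. \<open>f_conn\<close> says that endpoints on one
  circle are linked by the listed arcs alone.\<close>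

locale endpt_map =
  fixes m :: "(endpt \<times> endpt) list" and tc td :: bool and f :: "endpt \<Rightarrow> 'b" and orient :: "endpt \<Rightarrow> bool"
  assumes f_look: "f (look m p) = f p" and f_smooth_endpt: "f (smooth_endpt tc td p) = f p"
    and orient_look: "orient (look m p) \<longleftrightarrow> \<not> orient p" and orient_smooth_endpt: "orient (smooth_endpt tc td p) \<longleftrightarrow> \<not> orient p"
    and f_conn: "f p = f q \<Longrightarrow> (p, q) \<in> {(x, y). y = look m x \<or> y = smooth_endpt tc td x}\<^sup>*"
    and closed: "closed_table m tc td (table m tc td)"
begin

abbreviation "T \<equiv> table m tc td"

lemma trace_sound: "(q, b) \<in> set (trace m tc td n p) \<Longrightarrow> f q = f p \<and> orient p = (orient q = b)"
proof (induction n arbitrary: p)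
  case (Suc n)
  consider "(q, b) = (p, True)" | "(q, b) = (smooth_endpt tc td p, False)"
    | "(q, b) \<in> set (trace m tc td n (look m (smooth_endpt tc td p)))" using Suc.prems by auto
  then show ?case
  proof cases
    case 3
    from Suc.IH[OF this] show ?thesis by (simp add: f_look f_smooth_endpt orient_look orient_smooth_endpt)
  qed (auto simp: f_smooth_endpt orient_smooth_endpt)
qed simp

lemma rep_sound: "f (rep T p) = f p" "orient p = (orient (rep T p) = rep_sign T p)"
proof -
  have "look T p = leader endpts (trace m tc td 4 p)"
    unfolding table_def by (rule look_map) (simp add: set_endpts)
  moreover have "lmem p (trace m tc td 4 p)" by (simp add: numeral_eq_Suc)
  then have "leader endpts (trace m tc td 4 p) \<in> set (trace m tc td 4 p)"
    by (intro leader_mem) (metis set_endpts UNIV_I)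
  ultimately have "(rep T p, rep_sign T p) \<in> set (trace m tc td 4 p)" by (simp add: rep_def rep_sign_def)
  from trace_sound[OF this] show "f (rep T p) = f p" "orient p = (orient (rep T p) = rep_sign T p)" by auto
qed

text \<open>One direction is soundness of the trace. For the other, \<open>closed\<close> makes the
  representative constant along both kinds of arcs, and these connect all endpoints of a
  circle.\<close>

lemma rep_eq_iff: "rep T p = rep T q \<longleftrightarrow> f p = f q"
proof
  assume "f p = f q"
  from f_conn[OF this] show "rep T p = rep T q"
  proof (induction rule: rtrancl_induct)
    case (step y z)
    moreover have "rep T (smooth_endpt tc td y) = rep T y" "rep T (look m y) = rep T y"
      using closed unfolding closed_table_def list_all_iff set_endpts by blast+
    ultimately show ?case by auto
  qed simp
qed (metis rep_sound(1))

lemma rep_rep [simp]: "rep T (rep T p) = rep T p"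
  by (simp add: rep_eq_iff rep_sound)

end

definition bsgn :: "bool \<Rightarrow> int" where "bsgn b = (if b then 1 else -1)"

lemma bsgn_simps [simp]: "bsgn True = 1" "bsgn False = -1" "bsgn (\<not> b) = - bsgn b"
  "bsgn b * bsgn b = 1" by (simp_all add: bsgn_def)

lemma bsgn_eq: "bsgn (a = b) = bsgn a * bsgn b" by (simp add: bsgn_def)

lemma cancel_sum:
  "cancel n ts \<Longrightarrow> (\<Sum>(r, b) \<leftarrow> ts. bsgn b * y r) = 0"
proof (induction n ts rule: cancel.induct)
  case (3 n r s ts)
  then have mem: "(r, \<not> s) \<in> set ts" by (simp split: if_splits)
  have "(\<Sum>(r, b) \<leftarrow> ts. bsgn b * y r) = bsgn (\<not> s) * y r + (\<Sum>(r, b) \<leftarrow> remove1 (r, \<not> s) ts. bsgn b * y r)"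
    using sum_list_map_remove1[OF mem, of "\<lambda>(r, b). bsgn b * y r"] by simp
  then show ?case using 3 mem by simp
qed auto

fun kval :: "kind \<Rightarrow> int" where
  "kval (Merge b) = bsgn b" | "kval (Split b) = bsgn b" | "kval One_One = 0"

fun is_Split :: "kind \<Rightarrow> bool" where
  "is_Split (Split b) = True" | "is_Split _ = False"

text \<open>The sign identities are evaluated by rewriting, in batches of 27, 26, 26 and 26
  matchings.\<close>

lemma matchings_ok_1: "list_all matching_ok (take 27 (matchings 4 endpts))"
  by code_simp

lemma matchings_ok_2: "list_all matching_ok (take 26 (drop 27 (matchings 4 endpts)))"
  by code_simp

lemma matchings_ok_3: "list_all matching_ok (take 26 (drop 53 (matchings 4 endpts)))"
  by code_simp

lemma matchings_ok_4: "list_all matching_ok (drop 79 (matchings 4 endpts))"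
  by code_simp

lemma matchings_ok:
  assumes "m \<in> set (matchings 4 endpts)"
  shows "matching_ok m"
proof -
  have "list_all P xs" if "list_all P (take 27 xs)" "list_all P (take 26 (drop 27 xs))"
    "list_all P (take 26 (drop 53 xs))" "list_all P (drop 79 xs)" for P and xs :: "'b list"
  proof -
    have "drop 27 xs = take 26 (drop 27 xs) @ drop 53 xs" "drop 53 xs = take 26 (drop 53 xs) @ drop 79 xs"
      using append_take_drop_id[of 26 "drop 27 xs"] append_take_drop_id[of 26 "drop 53 xs"] by simp_all
    then show ?thesis using that by (metis append_take_drop_id list_all_append)
  qed
  then have "list_all matching_ok (matchings 4 endpts)"
    using matchings_ok_1 matchings_ok_2 matchings_ok_3 matchings_ok_4 by blast
  then show ?thesis using assms by (simp add: list_all_iff)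
qed

section \<open>Circles of a state and the outside matching\<close>

text \<open>Connectivity by diagram arcs and by the smoothings away from \<open>K\<close>, hence
  common to all states that agree off \<open>K\<close>. With \<open>K\<close> empty it is the circle
  relation, so the facts about it serve both purposes.\<close>

definition outside :: "('c, 'z) pdiag_scheme \<Rightarrow> 'c set \<Rightarrow> ('c \<Rightarrow> bool) \<Rightarrow> (('c \<times> quad) \<times> ('c \<times> quad)) set" where
  "outside D K s = ({(h, edg D h) | h. h \<in> halfs D} \<union> {(h, sm D s h) | h. h \<in> halfs D \<and> fst h \<notin> K})\<^sup>*"

lemma circ_rel_outside: "circ_rel D s = outside D {} s"
  unfolding circ_rel_def outside_def by simp

lemma outside_cong:
  assumes "\<And>x. x \<notin> K \<Longrightarrow> s x = t x"
  shows "outside D K s = outside D K t"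
proof -
  have "sm D s h = sm D t h" if "fst h \<notin> K" for h
    using assms[OF that] by (simp add: sm_def)
  then have "{(h, sm D s h) | h. h \<in> halfs D \<and> fst h \<notin> K} = {(h, sm D t h) | h. h \<in> halfs D \<and> fst h \<notin> K}"
    by (metis (no_types, lifting))
  then show ?thesis unfolding outside_def by simp
qed

lemma outside_mono: "outside D K s \<subseteq> circ_rel D s"
  unfolding outside_def circ_rel_def by (rule rtrancl_mono) auto

lemma outside_refl [simp]: "(h, h) \<in> outside D K s"
  unfolding outside_def by simp

lemma outside_trans: "(h, i) \<in> outside D K s \<Longrightarrow> (i, j) \<in> outside D K s \<Longrightarrow> (h, j) \<in> outside D K s"
  unfolding outside_def by (rule rtrancl_trans)

lemma outside_edg: "h \<in> halfs D \<Longrightarrow> (h, edg D h) \<in> outside D K s"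
  unfolding outside_def by (rule r_into_rtrancl) blast

lemma outside_sm: "h \<in> halfs D \<Longrightarrow> fst h \<notin> K \<Longrightarrow> (h, sm D s h) \<in> outside D K s"
  unfolding outside_def by (rule r_into_rtrancl) blast

lemma outside_induct [consumes 1, case_names base edg sm]:
  assumes "(h, k) \<in> outside D K s" "P h"
    and "\<And>i. (h, i) \<in> outside D K s \<Longrightarrow> i \<in> halfs D \<Longrightarrow> P i \<Longrightarrow> P (edg D i)"
    and "\<And>i. (h, i) \<in> outside D K s \<Longrightarrow> i \<in> halfs D \<Longrightarrow> fst i \<notin> K \<Longrightarrow> P i \<Longrightarrow> P (sm D s i)"
  shows "P k"
  using assms(1) unfolding outside_def
proof (induction rule: rtrancl_induct)
  case (step i j)
  then show ?case using assms(3,4) unfolding outside_def by blast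
qed fact

lemma fst_sm [simp]: "fst (sm D s h) = fst h"
  unfolding sm_def by simp

lemma vflip_vflip [simp]: "vflip (vflip q) = q" by (cases q) auto
lemma hflip_hflip [simp]: "hflip (hflip q) = q" by (cases q) auto

lemma sm_sm [simp]: "sm D s (sm D s h) = h"
  unfolding sm_def by (cases h) simp

lemma halfs_iff: "h \<in> halfs D \<longleftrightarrow> fst h \<in> Xs D"
  unfolding halfs_def by (cases h) auto

lemma sm_halfs [simp]: "sm D s h \<in> halfs D \<longleftrightarrow> h \<in> halfs D"
  by (simp add: halfs_iff)

locale ori_pdiag =
  fixes D :: "('c, 'z) pdiag_scheme" and ori :: "('c \<Rightarrow> bool) \<Rightarrow> 'c \<times> quad \<Rightarrow> bool"
  assumes finite_Xs: "finite (Xs D)"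
    and edg_halfs: "h \<in> halfs D \<Longrightarrow> edg D h \<in> halfs D"
    and edg_edg: "h \<in> halfs D \<Longrightarrow> edg D (edg D h) = h"
    and ori_edg: "s \<in> states D \<Longrightarrow> h \<in> halfs D \<Longrightarrow> ori s (edg D h) \<longleftrightarrow> \<not> ori s h"
    and ori_sm: "s \<in> states D \<Longrightarrow> h \<in> halfs D \<Longrightarrow> ori s (sm D s h) \<longleftrightarrow> \<not> ori s h"
begin

lemma finite_halfs: "finite (halfs D)"
proof -
  have "(UNIV :: quad set) = {NE, NW, SW, SE}" using quad.exhaust by auto
  then have "finite (UNIV :: quad set)" by (metis finite.emptyI finite_insert)
  then show ?thesis unfolding halfs_def using finite_Xs by auto
qed

lemma outside_halfs: "(h, k) \<in> outside D K s \<Longrightarrow> h \<in> halfs D \<Longrightarrow> k \<in> halfs D"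
  by (induction rule: outside_induct) (auto simp: edg_halfs)

lemma outside_sym:
  assumes "(h, k) \<in> outside D K s" "h \<in> halfs D"
  shows "(k, h) \<in> outside D K s"
  using assms(1)
proof (induction rule: outside_induct)
  case (edg i)
  then show ?case using outside_edg[OF edg_halfs[OF edg(2)]] by (metis edg_edg outside_trans)
next
  case (sm i)
  then have "(sm D s i, sm D s (sm D s i)) \<in> outside D K s"
    by (intro outside_sm) auto
  then show ?case using sm by (metis sm_sm outside_trans)
qed simp

lemma outside_eq:
  assumes "(h, k) \<in> outside D K s" "h \<in> halfs D"
  shows "(h, x) \<in> outside D K s \<longleftrightarrow> (k, x) \<in> outside D K s"
  using assms outside_sym outside_trans by metis

lemma outside_ori:
  assumes "(h, k) \<in> outside D K s" "s \<in> states D" "t \<in> states D" "\<And>x. x \<notin> K \<Longrightarrow> s x = t x"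
  shows "(ori s h = ori s k) = (ori t h = ori t k)"
  using assms(1)
proof (induction rule: outside_induct)
  case (sm i)
  moreover have "sm D s i = sm D t i" using sm assms(4) by (simp add: sm_def)
  ultimately show ?case using ori_sm[OF assms(2)] ori_sm[OF assms(3)] by metis
qed (use assms ori_edg in auto)

text \<open>Following a state from an endpoint away from K, one returns to K: the iterates of
  edg after sm are injective on a finite set, and the cycle through h ends with sm h.\<close>

lemma outer_ex:
  assumes h: "h \<in> halfs D" "fst h \<in> K"
  obtains k where "fst k \<in> K" "(h, k) \<in> outside D K s"
    "\<And>t. t \<in> states D \<Longrightarrow> (\<And>x. x \<notin> K \<Longrightarrow> s x = t x) \<Longrightarrow> ori t k \<noteq> ori t h"
    "\<And>x. (h, x) \<in> outside D K s \<Longrightarrow> fst x \<in> K \<Longrightarrow> x = h \<or> x = k"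
proof -
  define g where "g = (\<lambda>x. edg D (sm D s x))"
  define G where "G n = (g ^^ n) (edg D h)" for n
  have G0: "G 0 = edg D h" and GS: "G (Suc n) = edg D (sm D s (G n))" for n
    by (simp_all add: G_def g_def)
  have GH: "G n \<in> halfs D" for n
    by (induction n) (simp_all add: G0 GS edg_halfs h)
  have undo: "sm D s (edg D (G (Suc n))) = G n" for n
    using GH[of n] by (simp add: GS edg_edg)
  have "\<exists>i j. i < j \<and> G i = G j"
  proof (rule ccontr)
    assume "\<not> ?thesis"
    then have "inj G" by (metis injI linorder_neqE_nat)
    moreover have "finite (range G)" using GH finite_halfs by (metis finite_subset image_subsetI)
    ultimately show False using finite_imageD infinite_UNIV_nat by blast
  qed
  then obtain i j where ij: "i < j" "G i = G j" by blast
  have shift: "G 0 = G (j - i)" using ij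
  proof (induction i arbitrary: j)
    case (Suc i)
    then obtain j' where j: "j = Suc j'" by (cases j) auto
    have "G i = G j'" using Suc.prems undo[of i] undo[of j'] j by simp
    then show ?case using Suc.IH[of j'] Suc.prems j by simp
  qed simp
  then obtain n where n: "G 0 = G (Suc n)" using ij by (metis Suc_diff_Suc)
  have "G n = sm D s h" using undo[of n] h by (simp add: G0 edg_edg flip: n)
  then have "\<exists>n. fst (G n) \<in> K" using h by (metis fst_sm)
  then obtain k where k: "fst (G k) \<in> K" and least: "\<And>i. i < k \<Longrightarrow> fst (G i) \<notin> K"
    using exists_least_iff[of "\<lambda>n. fst (G n) \<in> K"] by auto
  have path: "(h, G i) \<in> outside D K s" if "i \<le> k" for i using that
  proof (induction i)
    case 0
    then show ?case using h by (simp add: G0 outside_edg)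
  next
    case (Suc i)
    then have "(G i, sm D s (G i)) \<in> outside D K s" using least GH by (intro outside_sm) auto
    moreover have "(sm D s (G i), G (Suc i)) \<in> outside D K s"
      using GH by (simp add: GS outside_edg)
    ultimately show ?case using Suc outside_trans by (meson Suc_leD)
  qed
  \<comment> \<open>The walk and its reversals: forwards it stops at \<open>G k\<close>, the first
    return to \<open>K\<close>, and backwards at \<open>edg D (G 0) = h\<close>, so
    \<open>?T\<close> is closed under the moves of \<open>outside\<close>.\<close>
  let ?T = "{G i | i. i \<le> k} \<union> {edg D (G i) | i. i \<le> k}"
  have sub: "x \<in> ?T" if "(h, x) \<in> outside D K s" for x using that
  proof (induction rule: outside_induct)
    case base
    then show ?case using h by (auto simp: G0 edg_edg intro: exI[of _ 0])
  next
    case (edg x)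
    then show ?case using GH by (auto simp: edg_edg)
  next
    case (sm x)
    from \<open>x \<in> ?T\<close> consider i where "i \<le> k" "x = G i" | i where "i \<le> k" "x = edg D (G i)" by auto
    then show ?case
    proof cases
      case 1
      then have "i < k" using sm k by (cases "i = k") auto
      moreover have "sm D s x = edg D (G (Suc i))" using 1 GH by (simp add: GS edg_edg)
      ultimately show ?thesis by (auto intro!: exI[of _ "Suc i"])
    next
      case 2
      have "i \<noteq> 0" using 2 sm h by (cases "i = 0") (auto simp: G0 edg_edg)
      then obtain i' where "i = Suc i'" by (cases i) auto
      then have "sm D s x = G i'" "i' \<le> k" using 2 undo by auto
      then show ?thesis by auto
    qed
  qed
  show ?thesis
  proof (rule that[of "G k"])
    show "fst (G k) \<in> K" by fact
    show "(h, G k) \<in> outside D K s" using path by simp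
    show "ori t (G k) \<noteq> ori t h" if t: "t \<in> states D" "\<And>x. x \<notin> K \<Longrightarrow> s x = t x" for t
    proof -
      have "ori t (G i) \<longleftrightarrow> \<not> ori t h" if "i \<le> k" for i using that
      proof (induction i)
        case 0
        then show ?case using h t by (simp add: G0 ori_edg)
      next
        case (Suc i)
        have "sm D s (G i) = sm D t (G i)" using least[of i] Suc t(2) by (simp add: sm_def)
        moreover have "sm D t (G i) \<in> halfs D" using GH by simp
        ultimately show ?case using Suc GH t by (simp add: GS ori_edg ori_sm)
      qed
      then show ?thesis by auto
    qed
    show "x = h \<or> x = G k" if "(h, x) \<in> outside D K s" "fst x \<in> K" for x
    proof -
      from sub[OF that(1)] consider i where "i \<le> k" "x = G i" | i where "i \<le> k" "x = edg D (G i)" by auto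
      then show ?thesis
      proof cases
        case 1
        then show ?thesis using least that by (cases "i = k") auto
      next
        case 2
        show ?thesis
        proof (cases i)
          case 0
          then show ?thesis using 2 h by (simp add: G0 edg_edg)
        next
          case (Suc i')
          then have "x = sm D s (G i')" using 2 GH by (simp add: GS edg_edg)
          then have "fst x = fst (G i')" by simp
          then show ?thesis using least[of i'] Suc 2 that by auto
        qed
      qed
    qed
  qed
qed

section \<open>The matching of the half-edges at K by the strands outside K\<close>

definition outer :: "'c set \<Rightarrow> ('c \<Rightarrow> bool) \<Rightarrow> 'c \<times> quad \<Rightarrow> 'c \<times> quad" where
  "outer K s h = (THE k. k \<noteq> h \<and> fst k \<in> K \<and> (h, k) \<in> outside D K s)"

context
  fixes K s h
  assumes s: "s \<in> states D" and h: "h \<in> halfs D" "fst h \<in> K"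
begin

lemma outer_props:
  shows outer_K: "fst (outer K s h) \<in> K"
    and outer_outside: "(h, outer K s h) \<in> outside D K s"
    and outer_ori: "t \<in> states D \<Longrightarrow> (\<And>x. x \<notin> K \<Longrightarrow> s x = t x) \<Longrightarrow> ori t (outer K s h) \<longleftrightarrow> \<not> ori t h"
    and outer_unique: "(h, x) \<in> outside D K s \<Longrightarrow> fst x \<in> K \<Longrightarrow> x = h \<or> x = outer K s h"
proof -
  obtain k where k: "fst k \<in> K" "(h, k) \<in> outside D K s"
    "\<And>t. t \<in> states D \<Longrightarrow> (\<And>x. x \<notin> K \<Longrightarrow> s x = t x) \<Longrightarrow> ori t k \<noteq> ori t h"
    "\<And>x. (h, x) \<in> outside D K s \<Longrightarrow> fst x \<in> K \<Longrightarrow> x = h \<or> x = k"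
    using outer_ex[OF h] by blast
  have "k \<noteq> h" using k(3)[OF s] by auto
  then have "outer K s h = k" unfolding outer_def using k by (intro the_equality) auto
  then show "fst (outer K s h) \<in> K" "(h, outer K s h) \<in> outside D K s"
    "t \<in> states D \<Longrightarrow> (\<And>x. x \<notin> K \<Longrightarrow> s x = t x) \<Longrightarrow> ori t (outer K s h) \<longleftrightarrow> \<not> ori t h"
    "(h, x) \<in> outside D K s \<Longrightarrow> fst x \<in> K \<Longrightarrow> x = h \<or> x = outer K s h"
    using k by auto
qed

lemma outer_halfs: "outer K s h \<in> halfs D"
  using outer_outside outside_halfs h by blast

lemma outer_neq: "outer K s h \<noteq> h"
  using outer_ori[OF s] by auto

end

lemma outer_outer:
  assumes "s \<in> states D" "h \<in> halfs D" "fst h \<in> K"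
  shows "outer K s (outer K s h) = h"
proof -
  let ?k = "outer K s h"
  have "(?k, h) \<in> outside D K s" using outside_sym outer_outside assms by blast
  then have "h = ?k \<or> h = outer K s ?k"
    using outer_unique[OF assms(1) outer_halfs[OF assms] outer_K[OF assms]] assms(3) by simp
  then show ?thesis using outer_neq[OF assms] by simp
qed

text \<open>The trace that a circle leaves on the half-edges at \<open>K\<close>, with each outside
  strand contracted to one application of \<open>outer\<close>.\<close>

definition near :: "'c set \<Rightarrow> ('c \<Rightarrow> bool) \<Rightarrow> (('c \<times> quad) \<times> ('c \<times> quad)) set" where
  "near K s = {(x, y). x \<in> halfs D \<and> fst x \<in> K \<and> (y = outer K s x \<or> y = sm D s x)}\<^sup>*"

lemma near_trans: "(x, y) \<in> near K s \<Longrightarrow> (y, z) \<in> near K s \<Longrightarrow> (x, z) \<in> near K s"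
  unfolding near_def by (rule rtrancl_trans)

text \<open>Invariant while following the circle: the current half-edge lies on the outside strand
  of a half-edge \<open>r\<close> at \<open>K\<close>, and \<open>r\<close> is already reached
  within \<open>near\<close>. Only a smoothing at \<open>K\<close> changes the strand.\<close>

lemma near_outside:
  assumes s: "s \<in> states D" and h: "h \<in> halfs D" "fst h \<in> K" and "(h, x) \<in> circ_rel D s"
  shows "\<exists>r \<in> halfs D. fst r \<in> K \<and> (h, r) \<in> near K s \<and> (r, x) \<in> outside D K s"
  using assms(4) unfolding circ_rel_outside
proof (induction rule: outside_induct)
  case base
  then show ?case using h by (auto simp: near_def)
next
  case (edg i)
  then show ?case using outside_trans[OF _ outside_edg[OF edg(2)]] by blast
next
  case (sm i)
  then obtain r where r: "r \<in> halfs D" "fst r \<in> K" "(h, r) \<in> near K s" "(r, i) \<in> outside D K s" by blast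
  show ?case
  proof (cases "fst i \<in> K")
    case True
    then have "i = r \<or> i = outer K s r" using outer_unique[OF s r(1,2) r(4)] by simp
    moreover have "(r, outer K s r) \<in> near K s"
      unfolding near_def using r by (intro r_into_rtrancl) auto
    ultimately have "(h, i) \<in> near K s" using r near_trans by blast
    moreover have "(i, sm D s i) \<in> near K s"
      unfolding near_def using sm True by (intro r_into_rtrancl) auto
    ultimately have "(h, sm D s i) \<in> near K s" by (rule near_trans)
    then show ?thesis using sm True by (intro bexI[of _ "sm D s i"]) auto
  next
    case False
    then show ?thesis using r outside_trans[OF r(4) outside_sm[OF sm(2)]] by blast
  qed
qed

lemma circ_rel_near:
  assumes "s \<in> states D" "h \<in> halfs D" "fst h \<in> K" "(h, x) \<in> circ_rel D s" "fst x \<in> K"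
  shows "(h, x) \<in> near K s"
proof -
  obtain r where r: "r \<in> halfs D" "fst r \<in> K" "(h, r) \<in> near K s" "(r, x) \<in> outside D K s"
    using near_outside assms by blast
  then have "x = r \<or> x = outer K s r" using outer_unique assms by blast
  moreover have "(r, outer K s r) \<in> near K s"
    unfolding near_def using r by (intro r_into_rtrancl) auto
  ultimately show ?thesis using r near_trans by blast
qed

lemma circ_rel_away:
  assumes "\<And>x. (h, x) \<in> outside D K s \<Longrightarrow> fst x \<notin> K"
  shows "(h, x) \<in> circ_rel D s \<longleftrightarrow> (h, x) \<in> outside D K s"
proof
  assume "(h, x) \<in> circ_rel D s"
  then show "(h, x) \<in> outside D K s" unfolding circ_rel_outside
  proof (induction rule: outside_induct)
    case (edg i) then show ?case using outside_trans[OF _ outside_edg[OF edg(2)]] by blast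
  next
    case (sm i) then show ?case using outside_trans[OF _ outside_sm[OF sm(2)]] assms by blast
  qed simp
qed (use outside_mono in blast)

lemma circ_of_eq_iff:
  assumes "h \<in> halfs D"
  shows "circ_of D s h = circ_of D s k \<longleftrightarrow> (h, k) \<in> circ_rel D s"
proof
  assume "circ_of D s h = circ_of D s k"
  then have "circ_rel D s `` {h} = circ_rel D s `` {k}" by (simp add: circ_of_def)
  then show "(h, k) \<in> circ_rel D s" unfolding circ_rel_outside by (metis Image_singleton_iff outside_refl)
next
  assume "(h, k) \<in> circ_rel D s"
  then show "circ_of D s h = circ_of D s k"
    using outside_eq[OF _ assms] unfolding circ_of_def circ_rel_outside by blast
qed

lemma circlesE:
  assumes "C \<in> circles D s"
  obtains h where "h \<in> halfs D" "C = circ_of D s h" | n where "C = FC n" "n < nfree D" | "C = PC" "pfree D"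
  using assms unfolding circles_def circ_of_def quotient_def by (auto split: if_splits)

lemma circ_of_circles: "h \<in> halfs D \<Longrightarrow> circ_of D s h \<in> circles D s"
  unfolding circles_def circ_of_def quotient_def by auto

lemma finite_circles: "finite (circles D s)"
  unfolding circles_def using finite_halfs by (auto simp: quotient_def)

end

section \<open>A single bifurcation\<close>

context ori_pdiag
begin

definition orient_sign :: "('c \<Rightarrow> bool) \<Rightarrow> 'c \<times> quad \<Rightarrow> int" where
  "orient_sign s h = (if ori s h then 1 else -1)"

lemma orient_sign_sq [simp]: "orient_sign s h * orient_sign s h = 1" "orient_sign s h * (orient_sign s h * z) = z"
  by (simp_all add: orient_sign_def)

lemma near_closed:
  assumes "(x, y) \<in> near K s" "x \<in> X" "\<And>z. z \<in> X \<Longrightarrow> z \<in> halfs D \<Longrightarrow> fst z \<in> K \<Longrightarrow> outer K s z \<in> X \<and> sm D s z \<in> X"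
  shows "y \<in> X"
  using assms(1) unfolding near_def
  by (induction rule: rtrancl_induct) (use assms in auto)

end

lemma sm_NW: "sm D s (c, NW) = (c, if ovr D c \<noteq> s c then SW else NE)"
  and sm_SE: "sm D s (c, SE) = (c, if ovr D c \<noteq> s c then NE else SW)"
  by (simp_all add: sm_def)

locale crossing = ori_pdiag D ori for D :: "('c, 'z) pdiag_scheme" and ori +
  fixes c :: 'c and s0 s1 :: "'c \<Rightarrow> bool"
  assumes c: "c \<in> Xs D" and s0: "s0 \<in> states D" "\<not> s0 c" and s1_def: "s1 = s0(c := True)"
begin

abbreviation "A0 \<equiv> circ_of D s0 (c, NW)"
abbreviation "B0 \<equiv> circ_of D s0 (c, SE)"
abbreviation "A1 \<equiv> circ_of D s1 (c, NW)"
abbreviation "B1 \<equiv> circ_of D s1 (c, SE)"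

lemma s1: "s1 \<in> states D" using s0 c by (auto simp: states_def s1_def)

lemma s01: "x \<notin> {c} \<Longrightarrow> s0 x = s1 x" by (simp add: s1_def)

lemma c_halfs [simp]: "(c, q) \<in> halfs D" using c by (simp add: halfs_iff)

text \<open>\<open>p0\<close> and \<open>p1\<close> name the other two half-edges independently of
  the sign of the crossing: \<open>s0\<close> joins NW with \<open>p0\<close> and SE with
  \<open>p1\<close>, while \<open>s1\<close> joins NW with \<open>p1\<close> and SE with
  \<open>p0\<close>.\<close>

definition "p0 = sm D s0 (c, NW)"
definition "p1 = sm D s1 (c, NW)"

lemma s1c: "s1 c" by (simp add: s1_def)

lemma p_val: "p0 = (c, if ovr D c then SW else NE)" "p1 = (c, if ovr D c then NE else SW)"
  using s0 s1c by (simp_all add: p0_def p1_def sm_NW)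

lemma sm_p: "sm D s0 (c, SE) = p1" "sm D s1 (c, SE) = p0" "sm D s0 p0 = (c, NW)" "sm D s0 p1 = (c, SE)"
  "sm D s1 p1 = (c, NW)" "sm D s1 p0 = (c, SE)"
  unfolding p_val using s0 s1c by (simp_all add: sm_def)

lemma endpoint_cases:
  assumes "fst h = c"
  shows "h = (c, NW) \<or> h = (c, SE) \<or> h = p0 \<or> h = p1"
  unfolding p_val using assms by (cases h; cases "snd h") auto

lemma p_neq: "p0 \<noteq> p1" "p0 \<noteq> (c, NW)" "p0 \<noteq> (c, SE)" "p1 \<noteq> (c, NW)" "p1 \<noteq> (c, SE)"
  unfolding p_val by auto

lemma fst_p [simp]: "fst p0 = c" "fst p1 = c" by (simp_all add: p0_def p1_def)

lemma p_halfs [simp]: "p0 \<in> halfs D" "p1 \<in> halfs D" using c by (simp_all add: halfs_iff)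

lemma circ_sm: "h \<in> halfs D \<Longrightarrow> circ_of D s (sm D s h) = circ_of D s h"
  using circ_of_eq_iff[of h s "sm D s h"] outside_sm[of h D "{}" s] by (simp add: circ_rel_outside)

lemma circ_p: "circ_of D s0 p0 = A0" "circ_of D s0 p1 = B0" "circ_of D s1 p1 = A1" "circ_of D s1 p0 = B1"
  using circ_sm[of p0 s0] circ_sm[of p1 s0] circ_sm[of p0 s1] circ_sm[of p1 s1] by (simp_all add: sm_p)

lemma outside_s1: "outside D {c} s1 = outside D {c} s0"
  by (rule outside_cong) (simp add: s1_def)

lemma outer_s1: "outer {c} s1 = outer {c} s0"
  by (simp add: outer_def outside_s1 fun_eq_iff)

lemma circ_outside:
  assumes "(h, k) \<in> outside D {c} s0" "h \<in> halfs D"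
  shows "circ_of D s0 h = circ_of D s0 k" "circ_of D s1 h = circ_of D s1 k"
  using assms outside_mono[of D "{c}" s0] outside_mono[of D "{c}" s1]
  by (auto simp: circ_of_eq_iff outside_s1)

lemma ori_p: "ori s0 p0 \<longleftrightarrow> \<not> ori s0 (c, NW)" "ori s0 p1 \<longleftrightarrow> \<not> ori s0 (c, SE)"
  "ori s1 p1 \<longleftrightarrow> \<not> ori s1 (c, NW)" "ori s1 p0 \<longleftrightarrow> \<not> ori s1 (c, SE)"
  using ori_sm[OF s0(1), of p0] ori_sm[OF s0(1), of p1] ori_sm[OF s1, of p0] ori_sm[OF s1, of p1]
  by (auto simp: sm_p)

text \<open>The strand leaving \<open>c\<close> at NW returns at SE, \<open>p0\<close> or
  \<open>p1\<close>, which gives a one-to-one bifurcation, a merge or a split. In the last two cases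
  the single circle passes NW and SE in the same direction relative to \<open>c\<close>, by reversal
  along the strand and along the smoothing arc.\<close>

lemma bifurcation_cases:
  obtains (one_one) "A0 = B0" "A1 = B1"
    | (merge) "A0 \<noteq> B0" "A1 = B1" "ori s1 (c, NW) = ori s1 (c, SE)"
    | (split) "A0 = B0" "A1 \<noteq> B1" "ori s0 (c, NW) = ori s0 (c, SE)"
proof -
  let ?m = "outer {c} s0"
  have fc: "fst (c, NW) \<in> {c}" "fst (c, SE) \<in> {c}" by auto
  note mm = outer_outer[OF s0(1), of _ "{c}"]
  have mN: "?m (c, NW) = (c, SE) \<or> ?m (c, NW) = p0 \<or> ?m (c, NW) = p1"
    using outer_K[OF s0(1) c_halfs fc(1)] outer_neq[OF s0(1) c_halfs fc(1)] endpoint_cases[of "?m (c, NW)"] by auto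
  note out = outer_outside[OF s0(1) c_halfs fc(1)]
  have or0: "ori s0 (?m (c, NW)) \<longleftrightarrow> \<not> ori s0 (c, NW)" by (rule outer_ori[OF s0(1) c_halfs fc(1) s0(1)]) simp
  have or1: "ori s1 (?m (c, NW)) \<longleftrightarrow> \<not> ori s1 (c, NW)"
    by (rule outer_ori[OF s0(1) c_halfs fc(1) s1]) (rule s01)
  show thesis
  proof (cases "?m (c, NW) = (c, SE)")
    case True
    then show ?thesis using one_one circ_outside[OF out] by simp
  next
    case F: False
    show ?thesis
    proof (cases "?m (c, NW) = p0")
      case True
      have "?m p0 = (c, NW)" using mm[of "(c, NW)"] True by simp
      \<comment> \<open>NW and \<open>p0\<close> are joined both outside and by the smoothing, so
        together they close up to a circle that avoids SE.\<close>
      then have "((c, NW), (c, SE)) \<notin> near {c} s0"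
        using near_closed[of "(c, NW)" "(c, SE)" "{c}" s0 "{(c, NW), p0}"] True p_neq
        by (metis sm_p(3) p0_def insertE insertI1 insertI2 singletonD Pair_inject quad.distinct(9))
      then have "A0 \<noteq> B0" using circ_rel_near[OF s0(1) c_halfs fc(1) _ fc(2)] circ_of_eq_iff by auto
      moreover have "A1 = B1" using circ_outside[OF out] circ_p True by simp
      moreover have "ori s1 (c, NW) = ori s1 (c, SE)" using or1 True ori_p by auto
      ultimately show ?thesis by (rule merge)
    next
      case False
      then have m: "?m (c, NW) = p1" using F mN by simp
      have "?m p1 = (c, NW)" using mm[of "(c, NW)"] m by simp
      then have "((c, NW), (c, SE)) \<notin> near {c} s1"
        using near_closed[of "(c, NW)" "(c, SE)" "{c}" s1 "{(c, NW), p1}"] m p_neq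
        by (metis sm_p(5) p1_def outer_s1 insertE insertI1 insertI2 singletonD Pair_inject quad.distinct(9))
      then have "A1 \<noteq> B1" using circ_rel_near[OF s1 c_halfs fc(1) _ fc(2)] circ_of_eq_iff by auto
      moreover have "A0 = B0" using circ_outside[OF out] circ_p m by simp
      moreover have "ori s0 (c, NW) = ori s0 (c, SE)" using or0 m ori_p by auto
      ultimately show ?thesis by (intro split)
    qed
  qed
qed

text \<open>Either the outside strand through \<open>h\<close> ends at \<open>c\<close>, and its
  circle is involved before and after; or the circle never meets \<open>c\<close> and is the same
  set of half-edges in both states.\<close>

lemma circ_touch:
  assumes h: "h \<in> halfs D"
  obtains (touch) e where "fst e = c" "(e, h) \<in> outside D {c} s0"
        "circ_of D s0 h \<in> {A0, B0}" "circ_of D s1 h \<in> {A1, B1}"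
        "circ_of D s0 h = circ_of D s0 e" "circ_of D s1 h = circ_of D s1 e"
    | (away) "circ_of D s1 h = circ_of D s0 h" "circ_of D s0 h \<notin> {A0, B0}" "circ_of D s1 h \<notin> {A1, B1}"
        "\<And>k. (h, k) \<in> circ_rel D s0 \<Longrightarrow> (h, k) \<in> outside D {c} s0"
proof (cases "\<exists>e. fst e = c \<and> (h, e) \<in> outside D {c} s0")
  case True
  then obtain e where e: "fst e = c" "(h, e) \<in> outside D {c} s0" by auto
  have "(e, h) \<in> outside D {c} s0" using outside_sym[OF e(2) h] .
  moreover have "circ_of D s0 e \<in> {A0, B0}" "circ_of D s1 e \<in> {A1, B1}"
    using endpoint_cases[OF e(1)] circ_p by auto
  ultimately show ?thesis using touch[OF e(1)] circ_outside[OF e(2) h] by simp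
next
  case False
  have rel0: "(h, k) \<in> circ_rel D s0 \<longleftrightarrow> (h, k) \<in> outside D {c} s0" for k
    by (rule circ_rel_away) (use False in auto)
  have rel1: "(h, k) \<in> circ_rel D s1 \<longleftrightarrow> (h, k) \<in> outside D {c} s0" for k
    unfolding outside_s1[symmetric] by (rule circ_rel_away) (use False in \<open>auto simp: outside_s1\<close>)
  have "circ_of D s1 h = circ_of D s0 h" unfolding circ_of_def using rel0 rel1 by auto
  moreover have "circ_of D s0 h \<notin> {A0, B0}" "circ_of D s1 h \<notin> {A1, B1}"
    using rel0 rel1 False h by (auto simp: circ_of_eq_iff)
  ultimately show ?thesis using away rel0 by auto
qed

lemma circles_rest: "circles D s0 - {A0, B0} = circles D s1 - {A1, B1}"
proof -
  have gc: "FC n \<noteq> circ_of D s h" "PC \<noteq> circ_of D s h" for n s h by (simp_all add: circ_of_def)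
  have fr: "FC n \<in> circles D s \<longleftrightarrow> n < nfree D" "PC \<in> circles D s \<longleftrightarrow> pfree D" for n s
    by (auto simp: circles_def)
  show ?thesis
  proof (intro set_eqI iffI)
    fix C assume C: "C \<in> circles D s0 - {A0, B0}"
    then have "C \<in> circles D s0" by simp
    then show "C \<in> circles D s1 - {A1, B1}"
    proof (cases rule: circlesE)
      case (1 h)
      from this(1) show ?thesis
        by (rule circ_touch) (use C 1 circ_of_circles[OF 1(1), of s1] in auto)
    qed (use gc fr in auto)
  next
    fix C assume C: "C \<in> circles D s1 - {A1, B1}"
    then have "C \<in> circles D s1" by simp
    then show "C \<in> circles D s0 - {A0, B0}"
    proof (cases rule: circlesE)
      case (1 h)
      from this(1) show ?thesis
        by (rule circ_touch) (use C 1 circ_of_circles[OF 1(1), of s0] in auto)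
    qed (use gc fr in auto)
  qed
qed

lemma AB_circles [simp]: "A0 \<in> circles D s0" "B0 \<in> circles D s0" "A1 \<in> circles D s1" "B1 \<in> circles D s1"
  by (simp_all add: circ_of_circles)

text \<open>Each smoothing joins NE and SW to NW and SE in some order, and a smoothing arc reverses
  the direction. Leaving through NE or SW is therefore entering through NW or SE, the half-edges
  that also fix the factor order.\<close>

lemma eps_circ:
  assumes "s = s0 \<or> s = s1" "h \<in> halfs D"
  shows "eps ori s c (circ_of D s h) =
    (if circ_of D s h = circ_of D s (c, NW) \<and> ori s (c, NW) \<or> circ_of D s h = circ_of D s (c, SE) \<and> ori s (c, SE) then 1 else -1)"
proof -
  have st: "s \<in> states D" using assms s0 s1 by auto
  have mem: "(h, k) \<in> circ_rel D s \<longleftrightarrow> circ_of D s h = circ_of D s k" for k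
    using circ_of_eq_iff[OF assms(2)] by auto
  have oN: "ori s (sm D s (c, NW)) \<longleftrightarrow> \<not> ori s (c, NW)" "ori s (sm D s (c, SE)) \<longleftrightarrow> \<not> ori s (c, SE)"
    using ori_sm[OF st] by auto
  have cN: "circ_of D s (sm D s (c, NW)) = circ_of D s (c, NW)" "circ_of D s (sm D s (c, SE)) = circ_of D s (c, SE)"
    by (simp_all add: circ_sm)
  have e: "eps ori s c (circ_of D s h) =
      (if circ_of D s h = circ_of D s (c, NE) \<and> \<not> ori s (c, NE) \<or>
          circ_of D s h = circ_of D s (c, SW) \<and> \<not> ori s (c, SW) then 1 else -1)"
    unfolding eps_def by (subst (1) circ_of_def) (simp add: mem)
  show ?thesis
  proof (cases "ovr D c = s c")
    case True
    then have "sm D s (c, NW) = (c, NE)" "sm D s (c, SE) = (c, SW)" by (simp_all add: sm_NW sm_SE)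
    then show ?thesis using oN cN e by simp
  next
    case False
    then have "sm D s (c, NW) = (c, SW)" "sm D s (c, SE) = (c, NE)" by (simp_all add: sm_NW sm_SE)
    then show ?thesis using oN cN e by (simp add: disj_commute)
  qed
qed

definition "one_to_one \<longleftrightarrow> A0 = B0 \<and> A1 = B1"

text \<open>If NW and SE lie on one circle, they have equal directions, so the disjunction in
  \<open>eps\<close> cannot mix two different answers. In a one-to-one bifurcation the directions
  are opposite, hence the exclusion.\<close>

lemma eps_endpoint:
  assumes "s = s0 \<or> s = s1" "\<not> one_to_one"
  shows "eps ori s c (circ_of D s (c, NW)) = orient_sign s (c, NW)" "eps ori s c (circ_of D s (c, SE)) = orient_sign s (c, SE)"
  using assms(1) by (cases rule: bifurcation_cases;
    use assms(2) in \<open>auto simp: eps_circ orient_sign_def one_to_one_def\<close>)+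

text \<open>Since X' is epsilon times X, the product of orientation sign and epsilon compares X_h
  with X'. That it is the same on both sides of the bifurcation means that \<open>m\<close> and
  \<open>\<Delta>\<close>, linear in X', are linear in X_h for any chosen orientations.\<close>

lemma eps_transport:
  assumes h: "h \<in> halfs D" and not: "\<not> one_to_one" and C: "circ_of D s0 h \<in> {A0, B0}"
  shows "orient_sign s0 h * eps ori s0 c (circ_of D s0 h) = orient_sign s1 h * eps ori s1 c (circ_of D s1 h)"
proof -
  from h obtain e where e: "fst e = c" "(e, h) \<in> outside D {c} s0"
     "circ_of D s0 h = circ_of D s0 e" "circ_of D s1 h = circ_of D s1 e"
    by (rule circ_touch) (use C in auto)
  have "(ori s0 e = ori s0 h) = (ori s1 e = ori s1 h)"
    by (rule outside_ori[OF e(2) s0(1) s1 s01])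
  moreover have "orient_sign s0 e * eps ori s0 c (circ_of D s0 e) = orient_sign s1 e * eps ori s1 c (circ_of D s1 e)"
    using endpoint_cases[OF e(1)] eps_endpoint[OF _ not, of s0] eps_endpoint[OF _ not, of s1]
    by (auto simp: circ_p) (auto simp: orient_sign_def ori_p)
  ultimately show ?thesis unfolding e(3,4) by (auto simp: orient_sign_def split: if_splits)
qed

end

section \<open>The complex with V on every circle\<close>

locale framed_pdiag = ori_pdiag D ori for D :: "('c, 'z) pdiag_scheme" and ori +
  fixes fori :: "('c \<Rightarrow> bool) \<Rightarrow> 'c circ \<Rightarrow> bool" and ordr :: "('c \<Rightarrow> bool) \<Rightarrow> 'c circ list"
  assumes distinct_ordr: "s \<in> states D \<Longrightarrow> distinct (ordr s)"
    and set_ordr: "s \<in> states D \<Longrightarrow> set (ordr s) = circles D s"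
begin

abbreviation zero :: "'c circ \<Rightarrow> bool" where "zero \<equiv> \<lambda>_. False"

definition agree_sign :: "('c \<Rightarrow> bool) \<Rightarrow> ('c \<Rightarrow> bool) \<Rightarrow> 'c circ \<Rightarrow> int" where
  "agree_sign s t C = (if agree ori fori s t C then 1 else -1)"

text \<open>Crossingless circles contain no half-edge, so they serve as their own marks. A mark
  names a circle in every state simultaneously, which lets one multiplication operator be followed
  through a bifurcation.\<close>

definition marks :: "('c \<times> quad + 'c circ) set" where
  "marks = Inl ` halfs D \<union> Inr ` {C. \<exists>n < nfree D. C = FC n} \<union> Inr ` {C. pfree D \<and> C = PC}"

definition mark_circ :: "('c \<Rightarrow> bool) \<Rightarrow> 'c \<times> quad + 'c circ \<Rightarrow> 'c circ" where
  "mark_circ s x = (case x of Inl h \<Rightarrow> circ_of D s h | Inr C \<Rightarrow> C)"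

definition mark_sign :: "('c \<Rightarrow> bool) \<Rightarrow> 'c \<times> quad + 'c circ \<Rightarrow> int" where
  "mark_sign s x = (case x of Inl h \<Rightarrow> orient_sign s h | Inr C \<Rightarrow> if fori s C then 1 else -1)"

lemma mark_sign_sq [simp]: "mark_sign s x * mark_sign s x = 1" "mark_sign s x * (mark_sign s x * z) = z"
  by (auto simp: mark_sign_def split: sum.splits)

lemma circles_mark:
  assumes "C \<in> circles D s"
  obtains x where "x \<in> marks" "C = mark_circ s x"
  using assms
proof (cases rule: circlesE)
  case (1 h) then show ?thesis using that[of "Inl h"] by (auto simp: marks_def mark_circ_def)
next
  case (2 n) then show ?thesis using that[of "Inr C"] by (auto simp: marks_def mark_circ_def)
next
  case 3 then show ?thesis using that[of "Inr C"] by (auto simp: marks_def mark_circ_def)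
qed

lemma mark_circ_circles: "x \<in> marks \<Longrightarrow> mark_circ s x \<in> circles D s"
  by (auto simp: marks_def mark_circ_def circ_of_circles) (auto simp: circles_def)

definition rest :: "'c \<Rightarrow> ('c \<Rightarrow> bool) \<Rightarrow> 'c circ set" where
  "rest c s = circles D s - {circ_of D s (c, NW), circ_of D s (c, SE)}"

text \<open>The signs of P_\<sigma> and P_\<rho> together. They depend on the circles alone, so a
  coefficient is this sign times a part that sees the labels; the value 0 records the vanishing of
  one-to-one bifurcations.\<close>

definition edge_sign :: "'c \<Rightarrow> ('c \<Rightarrow> bool) \<Rightarrow> int" where
  "edge_sign c s = (let s1 = s(c := True);
     A0 = circ_of D s (c, NW); B0 = circ_of D s (c, SE);
     A1 = circ_of D s1 (c, NW); B1 = circ_of D s1 (c, SE);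
     r = filter (\<lambda>C. C \<noteq> A0 \<and> C \<noteq> B0) (ordr s)
   in if A0 \<noteq> B0 then perm_sign (ordr s) (A0 # B0 # r) * perm_sign (A1 # r) (ordr s1)
      else if A1 \<noteq> B1 then perm_sign (ordr s) (A0 # r) * perm_sign (A1 # B1 # r) (ordr s1)
      else 0)"

definition local_coef :: "'c \<Rightarrow> ('c \<Rightarrow> bool) \<Rightarrow> ('c circ \<Rightarrow> bool) \<Rightarrow> ('c circ \<Rightarrow> bool) \<Rightarrow> int" where
  "local_coef c s b0 b1 = (let s1 = s(c := True);
     A0 = circ_of D s (c, NW); B0 = circ_of D s (c, SE);
     A1 = circ_of D s1 (c, NW); B1 = circ_of D s1 (c, SE)
   in if A0 \<noteq> B0 then m_VV (b0 A0) (b0 B0) (b1 A1) (eps ori s c A0) (eps ori s c B0) (eps ori s1 c A1)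
      else if A1 \<noteq> B1 then D_VV (b0 A0) (b1 A1) (b1 B1) (eps ori s c A0) (eps ori s1 c A1) (eps ori s1 c B1)
      else 0)"

text \<open>The coefficient of the complex in which projective circles carry V as well.\<close>

definition coefV :: "'c \<Rightarrow> ('c \<Rightarrow> bool) \<Rightarrow> ('c circ \<Rightarrow> bool) \<Rightarrow> ('c circ \<Rightarrow> bool) \<Rightarrow> int" where
  "coefV c s b0 b1 = (if \<forall>C \<in> rest c s. b1 C = b0 C
     then edge_sign c s * (\<Prod>C | C \<in> rest c s \<and> b0 C. agree_sign s (s(c := True)) C) * local_coef c s b0 b1 else 0)"

lemma labelings_upd: "b \<in> labelings D s \<Longrightarrow> C \<in> circles D s \<Longrightarrow> b(C := v) \<in> labelings D s"
  by (auto simp: labelings_def)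

lemma labelings_upd_False: "b \<in> labelings D s \<Longrightarrow> b(C := False) \<in> labelings D s"
  by (auto simp: labelings_def)

lemma finite_labelings: "finite (labelings D s)"
proof -
  have "labelings D s \<subseteq> (\<lambda>S C. C \<in> S) ` Pow (circles D s)"
  proof
    fix b assume "b \<in> labelings D s"
    then show "b \<in> (\<lambda>S C. C \<in> S) ` Pow (circles D s)"
      by (intro image_eqI[of _ _ "{C. b C}"]) (auto simp: labelings_def)
  qed
  then show ?thesis using finite_circles finite_subset by blast
qed

end

locale framed_crossing = crossing D ori c s0 s1 + framed_pdiag D ori fori ordr
  for D :: "('c, 'z) pdiag_scheme" and ori fori ordr c s0 s1
begin

lemma eps_sq [simp]: "eps ori s c C * eps ori s c C = 1" "eps ori s c C * (eps ori s c C * z) = z"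
  by (auto simp: eps_def split: circ.splits)

lemma rest_s1: "rest c s0 = circles D s1 - {A1, B1}"
  unfolding rest_def by (rule circles_rest)

lemma AB_rest [simp]: "A0 \<notin> rest c s0" "B0 \<notin> rest c s0" "A1 \<notin> rest c s0" "B1 \<notin> rest c s0"
  by (simp add: rest_def) (simp add: rest_def, simp_all add: rest_s1)

lemma finite_rest: "finite (rest c s0)" unfolding rest_def using finite_circles by simp

lemma mark_away:
  assumes "x \<in> marks" "mark_circ s0 x \<in> rest c s0"
  shows "mark_circ s1 x = mark_circ s0 x" "agree_sign s0 s1 (mark_circ s0 x) = mark_sign s0 x * mark_sign s1 x"
proof -
  have "mark_circ s1 x = mark_circ s0 x \<and> agree_sign s0 s1 (mark_circ s0 x) = mark_sign s0 x * mark_sign s1 x"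
  proof (cases x)
    case (Inl h)
    have h: "h \<in> halfs D" using assms Inl by (auto simp: marks_def)
    have r: "circ_of D s0 h \<notin> {A0, B0}" using assms Inl by (auto simp: mark_circ_def rest_def)
    have *: "circ_of D s1 h = circ_of D s0 h" "(h, k) \<in> circ_rel D s0 \<Longrightarrow> (h, k) \<in> outside D {c} s0" for k
      using circ_touch[OF h] r by blast+
    have "agree ori fori s0 s1 (circ_of D s0 h) \<longleftrightarrow> ori s0 h = ori s1 h"
    proof -
      have "(ori s0 h = ori s0 k) = (ori s1 h = ori s1 k)" if "(h, k) \<in> circ_rel D s0" for k
        by (rule outside_ori[OF *(2)[OF that] s0(1) s1 s01])
      moreover have "(h, h) \<in> circ_rel D s0" by (simp add: circ_rel_outside)
      ultimately show ?thesis unfolding agree_def circ_of_def by auto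
    qed
    then show ?thesis using * Inl by (simp add: mark_circ_def mark_sign_def agree_sign_def orient_sign_def)
  next
    case (Inr C)
    then have "agree ori fori s0 s1 C \<longleftrightarrow> fori s0 C = fori s1 C"
      using assms(1) by (auto simp: marks_def agree_def)
    then show ?thesis using Inr by (simp add: mark_circ_def mark_sign_def agree_sign_def)
  qed
  then show "mark_circ s1 x = mark_circ s0 x" "agree_sign s0 s1 (mark_circ s0 x) = mark_sign s0 x * mark_sign s1 x" by auto
qed

lemma mark_near:
  assumes "x \<in> marks" "mark_circ s0 x \<notin> rest c s0"
  shows "mark_circ s0 x \<in> {A0, B0}" "mark_circ s1 x \<in> {A1, B1}"
    "\<not> one_to_one \<Longrightarrow> mark_sign s0 x * mark_sign s1 x = eps ori s0 c (mark_circ s0 x) * eps ori s1 c (mark_circ s1 x)"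
proof -
  have C: "mark_circ s0 x \<in> {A0, B0}" using assms mark_circ_circles[of x s0] by (auto simp: rest_def)
  then obtain h where x: "x = Inl h" "h \<in> halfs D"
    using assms by (auto simp: marks_def mark_circ_def circ_of_def)
  have h: "circ_of D s0 h \<in> {A0, B0}" using C x by (simp add: mark_circ_def)
  show "mark_circ s0 x \<in> {A0, B0}" by (fact C)
  show "mark_circ s1 x \<in> {A1, B1}"
    by (rule circ_touch[OF x(2)]) (use h x in \<open>auto simp: mark_circ_def\<close>)
  assume "\<not> one_to_one"
  from eps_transport[OF x(2) this h] x
  have t: "mark_sign s0 x * eps ori s0 c (mark_circ s0 x) = mark_sign s1 x * eps ori s1 c (mark_circ s1 x)"
    by (simp add: mark_circ_def mark_sign_def)
  have "mark_sign s0 x * mark_sign s1 x = mark_sign s1 x * (mark_sign s0 x * eps ori s0 c (mark_circ s0 x)) * eps ori s0 c (mark_circ s0 x)"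
    by (simp add: mult.assoc mult.left_commute)
  also have "\<dots> = eps ori s0 c (mark_circ s0 x) * eps ori s1 c (mark_circ s1 x)"
    unfolding t by (simp add: mult.assoc mult.left_commute)
  finally show "mark_sign s0 x * mark_sign s1 x = eps ori s0 c (mark_circ s0 x) * eps ori s1 c (mark_circ s1 x)" .
qed

lemma local_coef_eq: "local_coef c s0 b0 b1 =
     (if A0 \<noteq> B0 then m_VV (b0 A0) (b0 B0) (b1 A1) (eps ori s0 c A0) (eps ori s0 c B0) (eps ori s1 c A1)
      else if A1 \<noteq> B1 then D_VV (b0 A0) (b1 A1) (b1 B1) (eps ori s0 c A0) (eps ori s1 c A1) (eps ori s1 c B1)
      else 0)"
  unfolding local_coef_def Let_def s1_def by simp

text \<open>The first claim is linearity of \<open>m\<close> and \<open>\<Delta>\<close> in X', with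
  the epsilons gathered into mark signs by \<open>mark_near\<close>. The second says that the image
  of a multiple of X_h is again one, hence has no component with 1 on the circle of the
  mark.\<close>

lemma local_coef_linear:
  assumes "x \<in> marks" "mark_circ s0 x \<notin> rest c s0"
  shows "\<not> b0 (mark_circ s0 x) \<Longrightarrow> local_coef c s0 (b0(mark_circ s0 x := True)) b1 =
      mark_sign s0 x * mark_sign s1 x * (if b1 (mark_circ s1 x) then local_coef c s0 b0 (b1(mark_circ s1 x := False)) else 0)"
    and "b0 (mark_circ s0 x) \<Longrightarrow> b1 (mark_circ s1 x) \<Longrightarrow> local_coef c s0 b0 (b1(mark_circ s1 x := False)) = 0"
proof -
  note m = mark_near[OF assms]
  have "(\<not> b0 (mark_circ s0 x) \<longrightarrow> local_coef c s0 (b0(mark_circ s0 x := True)) b1 =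
      mark_sign s0 x * mark_sign s1 x * (if b1 (mark_circ s1 x) then local_coef c s0 b0 (b1(mark_circ s1 x := False)) else 0)) \<and>
     (b0 (mark_circ s0 x) \<longrightarrow> b1 (mark_circ s1 x) \<longrightarrow> local_coef c s0 b0 (b1(mark_circ s1 x := False)) = 0)"
  proof (cases rule: bifurcation_cases)
    case one_one
    then show ?thesis by (simp add: local_coef_eq)
  next
    case merge
    then have "\<not> one_to_one" "mark_circ s1 x = A1" using m by (auto simp: one_to_one_def)
    then show ?thesis using m merge by (auto simp: local_coef_eq m_VV_def)
  next
    case split
    then have x0: "\<not> one_to_one" "mark_circ s0 x = A0" using m by (auto simp: one_to_one_def)
    have mk: "mark_sign s0 x * mark_sign s1 x = eps ori s0 c A0 * eps ori s1 c (mark_circ s1 x)"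
      using m(3)[OF x0(1)] x0(2) by simp
    from m(2) consider "mark_circ s1 x = A1" | "mark_circ s1 x = B1" by blast
    then show ?thesis
      by cases (use mk x0(2) split(2) split(2)[symmetric] in
        \<open>simp add: local_coef_eq D_VV_def split(1)[symmetric] del: fun_upd_apply; simp add: mult.assoc mult.left_commute\<close>)+
  qed
  then show "\<not> b0 (mark_circ s0 x) \<Longrightarrow> local_coef c s0 (b0(mark_circ s0 x := True)) b1 =
      mark_sign s0 x * mark_sign s1 x * (if b1 (mark_circ s1 x) then local_coef c s0 b0 (b1(mark_circ s1 x := False)) else 0)"
    "b0 (mark_circ s0 x) \<Longrightarrow> b1 (mark_circ s1 x) \<Longrightarrow> local_coef c s0 b0 (b1(mark_circ s1 x := False)) = 0" by auto
qed

lemma local_coef_cong: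
  assumes "b0 A0 = b0' A0" "b0 B0 = b0' B0" "b1 A1 = b1' A1" "b1 B1 = b1' B1"
  shows "local_coef c s0 b0 b1 = local_coef c s0 b0' b1'"
  using assms by (simp add: local_coef_eq)

lemma coefV_eq: "coefV c s0 b0 b1 = (if \<forall>C \<in> rest c s0. b1 C = b0 C
     then edge_sign c s0 * (\<Prod>C | C \<in> rest c s0 \<and> b0 C. agree_sign s0 s1 C) * local_coef c s0 b0 b1 else 0)"
  unfolding coefV_def s1_def by simp

text \<open>Multiplication by X_h, in coefficients: it sends a labelling with 1 on the circle of h to the
  one with X there, so on the target side it appears transposed.\<close>

lemma coefV_linear:
  assumes x: "x \<in> marks" and b0: "\<not> b0 (mark_circ s0 x)"
  shows "coefV c s0 (b0(mark_circ s0 x := True)) b1 =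
      mark_sign s0 x * mark_sign s1 x * (if b1 (mark_circ s1 x) then coefV c s0 b0 (b1(mark_circ s1 x := False)) else 0)"
proof (cases "mark_circ s0 x \<in> rest c s0")
  case True
  let ?C = "mark_circ s0 x"
  note m = mark_away[OF x True]
  have ne: "?C \<noteq> A0" "?C \<noteq> B0" "?C \<noteq> A1" "?C \<noteq> B1" using True AB_rest by metis+
  have P: "{C. C \<in> rest c s0 \<and> (b0(?C := True)) C} = insert ?C {C. C \<in> rest c s0 \<and> b0 C}"
    using True by auto
  have "(\<Prod>C | C \<in> rest c s0 \<and> (b0(?C := True)) C. agree_sign s0 s1 C) =
     agree_sign s0 s1 ?C * (\<Prod>C | C \<in> rest c s0 \<and> b0 C. agree_sign s0 s1 C)"
    unfolding P using b0 finite_rest by (subst prod.insert) auto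
  moreover have "(\<forall>C \<in> rest c s0. b1 C = (b0(?C := True)) C) \<longleftrightarrow>
      b1 ?C \<and> (\<forall>C \<in> rest c s0. (b1(?C := False)) C = b0 C)"
    using True b0 by auto
  moreover have "local_coef c s0 (b0(?C := True)) b1 = local_coef c s0 b0 (b1(?C := False))"
    using ne by (intro local_coef_cong) auto
  ultimately show ?thesis unfolding coefV_eq using m by (simp add: mult.assoc mult.left_commute)
next
  case False
  have C1: "mark_circ s1 x \<notin> rest c s0" using mark_near(2)[OF x False] by auto
  have "{C. C \<in> rest c s0 \<and> (b0(mark_circ s0 x := True)) C} = {C. C \<in> rest c s0 \<and> b0 C}"
    using False by auto
  moreover have "(\<forall>C \<in> rest c s0. b1 C = (b0(mark_circ s0 x := True)) C) \<longleftrightarrow> (\<forall>C \<in> rest c s0. b1 C = b0 C)"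
    using False by auto
  moreover have "(\<forall>C \<in> rest c s0. (b1(mark_circ s1 x := False)) C = b0 C) \<longleftrightarrow> (\<forall>C \<in> rest c s0. b1 C = b0 C)"
    using C1 by auto
  ultimately show ?thesis unfolding coefV_eq using local_coef_linear(1)[OF x False, of b0 b1] b0
    by simp
qed

text \<open>X_h squares to zero, so a labelling with X on the circle of \<open>x\<close> is never
  sent to one with 1 there. This disposes of the middle labellings that linearity does not
  produce.\<close>

lemma coefV_square_zero:
  assumes x: "x \<in> marks" and b0: "b0 (mark_circ s0 x)" and b1: "b1 (mark_circ s1 x)"
  shows "coefV c s0 b0 (b1(mark_circ s1 x := False)) = 0"
proof (cases "mark_circ s0 x \<in> rest c s0")
  case True
  then show ?thesis unfolding coefV_eq using mark_away[OF x True] b0 by (auto intro!: bexI[of _ "mark_circ s0 x"])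
next
  case False
  then show ?thesis unfolding coefV_eq using local_coef_linear(2)[where ?b0.0 = b0 and ?b1.0 = b1, OF x False b0 b1] by simp
qed

lemma labelings_rest_zero:
  assumes "b \<in> labelings D s1"
  shows "(\<forall>C \<in> rest c s0. b C = False) \<longleftrightarrow> (\<forall>C. b C \<longrightarrow> C = A1 \<or> C = B1)"
  using assms by (auto simp: rest_s1 labelings_def)

lemma coefV_zero_merge:
  assumes "b \<in> labelings D s1" "A0 \<noteq> B0"
  shows "coefV c s0 zero b = (if b = zero then edge_sign c s0 else 0)"
proof -
  have "A1 = B1" using assms(2) by (cases rule: bifurcation_cases) auto
  then have "b = zero \<longleftrightarrow> (\<forall>C \<in> rest c s0. b C = False) \<and> \<not> b A1"
    using labelings_rest_zero[OF assms(1)] by auto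
  then show ?thesis unfolding coefV_eq using assms(2) by (simp add: local_coef_eq m_VV_def)
qed

lemma coefV_zero_split:
  assumes "b \<in> labelings D s1" "A0 = B0" "A1 \<noteq> B1"
  shows "coefV c s0 zero b = edge_sign c s0 * ((if b = zero(A1 := True) then orient_sign s1 (c, NW) else 0)
     + (if b = zero(B1 := True) then orient_sign s1 (c, SE) else 0))"
proof -
  have no: "\<not> one_to_one" using assms by (simp add: one_to_one_def)
  have 1: "b = zero(A1 := True) \<longleftrightarrow> (\<forall>C \<in> rest c s0. b C = False) \<and> b A1 \<and> \<not> b B1"
    using labelings_rest_zero[OF assms(1)] assms(3) by (auto simp: fun_eq_iff)
  have 2: "b = zero(B1 := True) \<longleftrightarrow> (\<forall>C \<in> rest c s0. b C = False) \<and> \<not> b A1 \<and> b B1"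
    using labelings_rest_zero[OF assms(1)] assms(3) by (auto simp: fun_eq_iff)
  show ?thesis unfolding coefV_eq 1 2 using assms(2,3) eps_endpoint[of s1] no
    by (simp add: local_coef_eq D_VV_def)
qed

lemma edge_sign_one_one: "one_to_one \<Longrightarrow> edge_sign c s0 = 0"
  by (simp add: edge_sign_def one_to_one_def Let_def flip: s1_def)

end

section \<open>Composites of two bifurcations\<close>

context framed_pdiag
begin

lemma framed_crossing:
  assumes "c \<in> Xs D" "s \<in> states D" "\<not> s c"
  shows "framed_crossing D ori ordr c s (s(c := True))"
proof -
  interpret crossing D ori c s "s(c := True)"
    by unfold_locales (use assms in auto)
  show ?thesis by unfold_locales
qed

definition face_coef :: "'c \<Rightarrow> 'c \<Rightarrow> ('c \<Rightarrow> bool) \<Rightarrow> ('c circ \<Rightarrow> bool) \<Rightarrow> ('c circ \<Rightarrow> bool) \<Rightarrow> int" where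
  "face_coef c d s b0 b2 = (\<Sum>b1 \<in> labelings D (s(c := True)). coefV c s b0 b1 * coefV d (s(c := True)) b1 b2)"

definition mulX :: "('c \<Rightarrow> bool) \<Rightarrow> 'c \<times> quad \<Rightarrow> (('c circ \<Rightarrow> bool) \<Rightarrow> int) \<Rightarrow> ('c circ \<Rightarrow> bool) \<Rightarrow> int" where
  "mulX s p g b = orient_sign s p * (if b (circ_of D s p) then g (b(circ_of D s p := False)) else 0)"

definition unit_chain :: "('c circ \<Rightarrow> bool) \<Rightarrow> int" where
  "unit_chain b = (if b = zero then 1 else 0)"

text \<open>This also holds for a one-to-one bifurcation; there \<open>edge_sign\<close> is 0, so
  the factor chosen by \<open>mulE\<close> does not affect the product.\<close>

definition splits :: "'c \<Rightarrow> ('c \<Rightarrow> bool) \<Rightarrow> bool" where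
  "splits c s \<longleftrightarrow> circ_of D s (c, NW) = circ_of D s (c, SE)"

definition mulE :: "('c \<Rightarrow> bool) \<Rightarrow> 'c \<Rightarrow> bool \<Rightarrow> (('c circ \<Rightarrow> bool) \<Rightarrow> int) \<Rightarrow> ('c circ \<Rightarrow> bool) \<Rightarrow> int" where
  "mulE s c e g b = (if e then mulX s (c, NW) g b + mulX s (c, SE) g b else g b)"

lemma mulX_commute: "mulX s p (mulX s q g) b = mulX s q (mulX s p g) b"
  by (auto simp: mulX_def fun_upd_twist mult.left_commute)

lemma mulX_add: "mulX s p (\<lambda>b. f b + g b) b = mulX s p f b + mulX s p g b"
  by (simp add: mulX_def distrib_left)

lemma mulE_commute: "mulE s c e (mulE s d e' g) b = mulE s d e' (mulE s c e g) b"
proof -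
  have E: "mulE s c True g = (\<lambda>b. mulX s (c, NW) g b + mulX s (c, SE) g b)" "mulE s c False g = g" for s c g
    by (auto simp: mulE_def)
  show ?thesis
    by (cases e; cases e') (simp_all add: E mulX_add mulX_commute[of s "(c, _)"])
qed

end

locale face = framed_pdiag D ori fori ordr
  for D :: "('c, 'z) pdiag_scheme" and ori fori ordr +
  fixes c d :: 'c and s :: "'c \<Rightarrow> bool"
  assumes cd: "c \<in> Xs D" "d \<in> Xs D" "c \<noteq> d" and st: "s \<in> states D" "\<not> s c" "\<not> s d"
begin

lemma s10: "s(c := True) \<in> states D" "\<not> (s(c := True)) d"
  using cd st by (auto simp: states_def)

lemma first: "framed_crossing D ori ordr c s (s(c := True))"
  using framed_crossing cd st by blast

lemma second: "framed_crossing D ori ordr d (s(c := True)) (s(c := True, d := True))"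
  using framed_crossing[of d "s(c := True)"] cd s10 by blast

interpretation E1: framed_crossing D ori fori ordr c s "s(c := True)" by (rule first)
interpretation E2: framed_crossing D ori fori ordr d "s(c := True)" "s(c := True, d := True)" by (rule second)

text \<open>The mark sign of the middle state enters once from each edge and squares to 1. The
  formula thus refers only to the two end states, and is the same for both orders of the
  crossings.\<close>

lemma face_coef_linear:
  assumes x: "x \<in> marks" and b0: "\<not> b0 (mark_circ s x)"
  shows "face_coef c d s (b0(mark_circ s x := True)) b2 =
      mark_sign s x * mark_sign (s(c := True, d := True)) x *
      (if b2 (mark_circ (s(c := True, d := True)) x)
       then face_coef c d s b0 (b2(mark_circ (s(c := True, d := True)) x := False)) else 0)"
proof -
  let ?s1 = "s(c := True)" and ?s2 = "s(c := True, d := True)"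
  let ?C1 = "mark_circ ?s1 x" and ?C2 = "mark_circ ?s2 x"
  let ?L = "labelings D ?s1"
  let ?Lo = "{b \<in> ?L. \<not> b ?C1}" and ?Li = "{b \<in> ?L. b ?C1}"
  have "?L = ?Lo \<union> ?Li" by auto
  then have parts: "sum f ?L = sum f ?Lo + sum f ?Li" for f :: "_ \<Rightarrow> int"
    using sum.union_disjoint[of ?Lo ?Li f] finite_labelings[of ?s1] by (auto simp: disjoint_iff)
  \<comment> \<open>Linearity on the first edge leaves only middle labellings with X on the circle
    of \<open>x\<close>; these are then matched with labellings carrying 1 there.\<close>
  have "face_coef c d s (b0(mark_circ s x := True)) b2 =
      (\<Sum>b1 \<in> ?Li. mark_sign s x * mark_sign ?s1 x * coefV c s b0 (b1(?C1 := False)) * coefV d ?s1 b1 b2)"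
  proof -
    let ?f = "\<lambda>b1. coefV c s (b0(mark_circ s x := True)) b1 * coefV d ?s1 b1 b2"
    have "sum ?f ?Lo = 0"
      by (rule sum.neutral) (simp add: E1.coefV_linear[where ?b0.0 = b0, OF x b0])
    moreover have "sum ?f ?Li = (\<Sum>b1 \<in> ?Li. mark_sign s x * mark_sign ?s1 x * coefV c s b0 (b1(?C1 := False)) * coefV d ?s1 b1 b2)"
      by (rule sum.cong) (simp_all add: E1.coefV_linear[where ?b0.0 = b0, OF x b0])
    ultimately show ?thesis unfolding face_coef_def parts by simp
  qed
  also have "\<dots> = (\<Sum>b \<in> ?Lo. mark_sign s x * mark_sign ?s1 x * coefV c s b0 b * coefV d ?s1 (b(?C1 := True)) b2)"
    by (rule sum.reindex_bij_witness[of _ "\<lambda>b. b(?C1 := True)" "\<lambda>b. b(?C1 := False)"])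
      (auto simp: fun_upd_idem labelings_upd labelings_upd_False mark_circ_circles[OF x])
  also have "\<dots> = (\<Sum>b \<in> ?Lo. mark_sign s x * mark_sign ?s2 x *
      (if b2 ?C2 then coefV c s b0 b * coefV d ?s1 b (b2(?C2 := False)) else 0))"
    by (rule sum.cong) (auto simp: E2.coefV_linear[OF x] mult.assoc mult.left_commute)
  also have "\<dots> = mark_sign s x * mark_sign ?s2 x * (if b2 ?C2 then
      (\<Sum>b \<in> ?Lo. coefV c s b0 b * coefV d ?s1 b (b2(?C2 := False))) else 0)"
    by (simp add: sum_distrib_left)
  \<comment> \<open>Middle labellings with X on the circle of \<open>x\<close> may be added back:
    their coefficient to a target with 1 on that circle is zero.\<close>
  also have "\<dots> = mark_sign s x * mark_sign ?s2 x * (if b2 ?C2 then face_coef c d s b0 (b2(?C2 := False)) else 0)"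
    unfolding face_coef_def parts by (auto simp: E2.coefV_square_zero[OF x] intro!: sum.neutral)
  finally show ?thesis .
qed

lemma coefV_second:
  assumes "b \<in> labelings D (s(c := True, d := True))"
  shows "coefV d (s(c := True)) zero b = edge_sign d (s(c := True)) *
    mulE (s(c := True, d := True)) d (splits d (s(c := True))) unit_chain b"
proof (cases rule: E2.bifurcation_cases)
  case one_one
  then have o: "E2.one_to_one" by (simp add: E2.one_to_one_def)
  show ?thesis unfolding coefV_def using E2.edge_sign_one_one[OF o] by simp
next
  case merge
  then show ?thesis using E2.coefV_zero_merge[OF assms] by (simp add: mulE_def splits_def unit_chain_def)
next
  case split
  have "b = zero(C := True) \<longleftrightarrow> b C \<and> b(C := False) = zero" for C
    by (auto simp: fun_eq_iff)
  then show ?thesis using E2.coefV_zero_split[OF assms split(1,2)] split(1)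
    by (simp add: mulE_def mulX_def splits_def unit_chain_def)
qed

lemma face_coef_zero:
  assumes b: "b \<in> labelings D (s(c := True, d := True))"
  shows "face_coef c d s zero b = edge_sign c s * edge_sign d (s(c := True)) *
    mulE (s(c := True, d := True)) c (splits c s)
     (mulE (s(c := True, d := True)) d (splits d (s(c := True))) unit_chain) b"
proof -
  let ?s1 = "s(c := True)" and ?s2 = "s(c := True, d := True)"
  have z: "zero \<in> labelings D ?s1" by (simp add: labelings_def)
  show ?thesis
  proof (cases rule: E1.bifurcation_cases)
    case one_one
    then have "E1.one_to_one" by (simp add: E1.one_to_one_def)
    from E1.edge_sign_one_one[OF this] show ?thesis by (auto simp: face_coef_def coefV_def[of c] intro!: sum.neutral)
  next
    case merge
    have "face_coef c d s zero b = (\<Sum>b1 \<in> labelings D ?s1. if b1 = zero then edge_sign c s * coefV d ?s1 zero b else 0)"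
      unfolding face_coef_def by (rule sum.cong) (simp_all add: E1.coefV_zero_merge merge)
    also have "\<dots> = edge_sign c s * coefV d ?s1 zero b"
      using z finite_labelings by (simp add: sum.delta)
    finally show ?thesis using merge(1) coefV_second[OF b] by (simp add: mulE_def[of _ c] splits_def[of c])
  next
    case split
    have one: "zero(circ_of D ?s1 (c, q) := True) \<in> labelings D ?s1" for q
      using cd by (intro labelings_upd z circ_of_circles) (simp add: halfs_iff)
    \<comment> \<open>The X created by the first split lives in the middle state; linearity moves it
      past the second edge into the final state, where both composites can be compared.\<close>
    have Xlin: "orient_sign ?s1 (c, q) * coefV d ?s1 (zero(circ_of D ?s1 (c, q) := True)) b =
       mulX ?s2 (c, q) (coefV d ?s1 zero) b" for q
    proof -
      have "Inl (c, q) \<in> marks" using cd by (simp add: marks_def halfs_iff)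
      from E2.coefV_linear[OF this, of zero b]
      show ?thesis by (simp add: mark_circ_def mark_sign_def mulX_def mult.assoc)
    qed
    have "face_coef c d s zero b = (\<Sum>b1 \<in> labelings D ?s1.
       (if b1 = zero(circ_of D ?s1 (c, NW) := True) then edge_sign c s * orient_sign ?s1 (c, NW) * coefV d ?s1 b1 b else 0) +
       (if b1 = zero(circ_of D ?s1 (c, SE) := True) then edge_sign c s * orient_sign ?s1 (c, SE) * coefV d ?s1 b1 b else 0))"
      unfolding face_coef_def by (rule sum.cong) (simp_all add: E1.coefV_zero_split split(1,2) algebra_simps)
    also have "\<dots> = edge_sign c s * orient_sign ?s1 (c, NW) * coefV d ?s1 (zero(circ_of D ?s1 (c, NW) := True)) b +
        edge_sign c s * orient_sign ?s1 (c, SE) * coefV d ?s1 (zero(circ_of D ?s1 (c, SE) := True)) b"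
      using one finite_labelings by (simp add: sum.distrib sum.delta)
    also have "\<dots> = edge_sign c s * (mulX ?s2 (c, NW) (coefV d ?s1 zero) b + mulX ?s2 (c, SE) (coefV d ?s1 zero) b)"
      using Xlin by (simp add: mult.assoc distrib_left)
    also have "\<dots> = edge_sign c s * edge_sign d ?s1 * (mulX ?s2 (c, NW) (mulE ?s2 d (splits d ?s1) unit_chain) b +
        mulX ?s2 (c, SE) (mulE ?s2 d (splits d ?s1) unit_chain) b)"
      using coefV_second[OF labelings_upd_False[OF b]] by (simp add: mulX_def algebra_simps)
    finally show ?thesis using split(1) by (simp add: mulE_def[of _ c] splits_def[of c])
  qed
qed

end

context face
begin

lemma swap_face: "face D ori ordr d c s"
  by unfold_locales (use cd st in auto)

text \<open>Induction on the circles labelled X: removing one label is undoing a multiplication by a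
  mark, and both composites carry it to the same multiplication in the final state.\<close>

lemma face_coef_anticommute:
  assumes base: "\<And>b2. b2 \<in> labelings D (s(c := True, d := True)) \<Longrightarrow>
      face_coef c d s zero b2 + face_coef d c s zero b2 = 0"
    and b0: "b0 \<in> labelings D s" and "b2 \<in> labelings D (s(c := True, d := True))"
  shows "face_coef c d s b0 b2 + face_coef d c s b0 b2 = 0"
proof -
  let ?s2 = "s(c := True, d := True)"
  have fin: "finite {C. b0 C}"
    using b0 finite_circles[of s] by (auto simp: labelings_def intro: finite_subset)
  have tw: "s(d := True, c := True) = ?s2" using cd by (simp add: fun_upd_twist)
  from fin b0 assms(3) show ?thesis
  proof (induction "{C. b0 C}" arbitrary: b0 b2 rule: finite_induct)
    case empty
    then have "b0 = zero" by auto
    then show ?case using base[OF empty(3)] by simp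
  next
    case (insert C F)
    let ?b = "b0(C := False)"
    have bC: "b0 C" using insert.hyps by auto
    then have "C \<in> circles D s" using insert.prems by (simp add: labelings_def)
    then obtain x where x: "x \<in> marks" "C = mark_circ s x" by (rule circles_mark)
    have F: "F = {C. ?b C}" using insert.hyps by auto
    have upd: "?b(mark_circ s x := True) = b0" "\<not> ?b (mark_circ s x)" using x bC by (auto simp: fun_upd_idem)
    have IH: "face_coef c d s ?b (b2(mark_circ ?s2 x := False)) + face_coef d c s ?b (b2(mark_circ ?s2 x := False)) = 0"
      by (rule insert.hyps(3)[OF F]) (intro labelings_upd_False insert.prems)+
    have "face_coef c d s b0 b2 = mark_sign s x * mark_sign ?s2 x *
        (if b2 (mark_circ ?s2 x) then face_coef c d s ?b (b2(mark_circ ?s2 x := False)) else 0)"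
      using face_coef_linear[where ?b0.0 = ?b, OF x(1) upd(2)] upd(1) by simp
    moreover have "face_coef d c s b0 b2 = mark_sign s x * mark_sign ?s2 x *
        (if b2 (mark_circ ?s2 x) then face_coef d c s ?b (b2(mark_circ ?s2 x := False)) else 0)"
      using face.face_coef_linear[where ?b0.0 = ?b, OF swap_face x(1) upd(2)] upd(1) tw by simp
    ultimately show ?case using IH by (simp flip: distrib_left)
  qed
qed

end

section \<open>Projective circles\<close>

locale proj_pdiag = framed_pdiag D ori fori ordr for D :: "('c, 'z) pdiag_scheme" and ori fori ordr +
  assumes twist_edg: "h \<in> halfs D \<Longrightarrow> twist D (edg D h) = twist D h"
    and proj_last: "s \<in> states D \<Longrightarrow> C \<in> circles D s \<Longrightarrow> is_proj D C \<Longrightarrow> last (ordr s) = C"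
begin

text \<open>An admissible order puts every projective circle last, and only one circle can be
  last.\<close>

lemma proj_unique:
  assumes "s \<in> states D" "C \<in> circles D s" "is_proj D C" "C' \<in> circles D s" "is_proj D C'"
  shows "C = C'"
  using proj_last[OF assms(1)] assms(2-) by metis

definition twists :: "('c \<Rightarrow> bool) \<Rightarrow> 'c circ \<Rightarrow> ('c \<times> quad) set" where
  "twists s C = {k \<in> halfs D. circ_of D s k = C \<and> twist D k}"

lemma finite_twists: "finite (twists s C)"
  unfolding twists_def using finite_halfs by simp

text \<open>An arc pairs a twisted half-edge traversed towards its crossing with one traversed away
  from it. The halving in \<open>is_proj\<close> therefore loses nothing and is additive when
  circles are united.\<close>

lemma even_twists:
  assumes s: "s \<in> states D"
  shows "even (card (twists s C))"
proof -
  let ?W = "\<lambda>b. {k \<in> twists s C. ori s k = b}"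
  have e: "edg D k \<in> ?W (\<not> b)" if "k \<in> ?W b" for k b
  proof -
    have k: "k \<in> halfs D" using that by (simp add: twists_def)
    have "circ_of D s (edg D k) = circ_of D s k"
      using circ_of_eq_iff[OF k, of s "edg D k"] outside_edg[OF k, of "{}" s] by (simp add: circ_rel_outside)
    then show ?thesis using that k s by (simp add: twists_def edg_halfs twist_edg ori_edg)
  qed
  have "bij_betw (edg D) (?W True) (?W False)"
    by (rule bij_betw_byWitness[of _ "edg D"])
      (use e[of _ True] e[of _ False] edg_edg in \<open>auto simp: twists_def\<close>)
  then have "card (?W True) = card (?W False)" by (rule bij_betw_same_card)
  moreover have "card (twists s C) = card (?W True) + card (?W False)"
    by (subst card_Un_disjoint[symmetric]) (auto simp: finite_twists intro: arg_cong[where f = card])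
  ultimately show ?thesis by simp
qed

lemma is_proj_twists:
  assumes "h \<in> halfs D"
  shows "is_proj D (circ_of D s h) \<longleftrightarrow> odd (card (twists s (circ_of D s h)) div 2)"
proof -
  have "{k \<in> circ_rel D s `` {h}. twist D k} = twists s (circ_of D s h)"
  proof -
    have "k \<in> halfs D \<and> circ_of D s k = circ_of D s h \<longleftrightarrow> (h, k) \<in> circ_rel D s" for k
      using circ_of_eq_iff[OF assms, of s k] outside_halfs[of h k "{}" s] assms
      by (auto simp: circ_rel_outside)
    then show ?thesis unfolding twists_def by blast
  qed
  moreover have "is_proj D (circ_of D s h) \<longleftrightarrow> odd (card {k \<in> circ_rel D s `` {h}. twist D k} div 2)"
    unfolding is_proj_def circ_of_def by simp
  ultimately show ?thesis by simp
qed

lemma proj_sum: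
  assumes "s \<in> states D" "t \<in> states D" "twists s C = twists t A \<union> twists t B" "A \<noteq> B"
  shows "odd (card (twists s C) div 2) \<longleftrightarrow> odd (card (twists t A) div 2) \<noteq> odd (card (twists t B) div 2)"
proof -
  have "card (twists s C) = card (twists t A) + card (twists t B)"
    unfolding assms(3) by (rule card_Un_disjoint) (use assms(4) in \<open>auto simp: finite_twists\<close>, auto simp: twists_def)
  then have "card (twists s C) div 2 = card (twists t A) div 2 + card (twists t B) div 2"
    using even_twists[OF assms(2)] by (auto elim!: evenE)
  then show ?thesis by simp
qed

text \<open>The filtration level: the label of the projective circle, and \<open>False\<close> if
  there is none.\<close>

definition plab :: "('c \<Rightarrow> bool) \<Rightarrow> ('c circ \<Rightarrow> bool) \<Rightarrow> bool" where
  "plab s b \<longleftrightarrow> (\<exists>C \<in> circles D s. is_proj D C \<and> b C)"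

lemma plab_eq:
  assumes "s \<in> states D" "C \<in> circles D s" "is_proj D C"
  shows "plab s b = b C"
  unfolding plab_def using assms proj_unique[OF assms(1)] by blast

end

locale proj_crossing = framed_crossing D ori fori ordr c s0 s1 + proj_pdiag D ori fori ordr
  for D :: "('c, 'z) pdiag_scheme" and ori fori ordr c s0 s1
begin

lemma touch_iff:
  assumes "k \<in> halfs D"
  shows "circ_of D s0 k \<in> {A0, B0} \<longleftrightarrow> circ_of D s1 k \<in> {A1, B1}"
  using assms by (rule circ_touch) auto

lemma proj_merge:
  assumes "A0 \<noteq> B0" shows "is_proj D A1 \<longleftrightarrow> is_proj D A0 \<noteq> is_proj D B0"
proof -
  have "A1 = B1" using assms by (cases rule: bifurcation_cases) auto
  then have "twists s1 A1 = twists s0 A0 \<union> twists s0 B0"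
    using touch_iff by (auto simp: twists_def)
  from proj_sum[OF s1 s0(1) this assms] show ?thesis by (simp add: is_proj_twists)
qed

lemma proj_split:
  assumes "A0 = B0" "A1 \<noteq> B1" shows "is_proj D A0 \<longleftrightarrow> is_proj D A1 \<noteq> is_proj D B1"
proof -
  have "twists s0 A0 = twists s1 A1 \<union> twists s1 B1"
    using touch_iff by (auto simp: twists_def assms(1))
  from proj_sum[OF s0(1) s1 this assms(2)] show ?thesis by (simp add: is_proj_twists)
qed

definition local_coefP :: "('c circ \<Rightarrow> bool) \<Rightarrow> ('c circ \<Rightarrow> bool) \<Rightarrow> int" where
  "local_coefP b0 b1 = (if A0 \<noteq> B0 then
       (if is_proj D A0 then m_PV else if is_proj D B0 then m_VP else m_VV)
        (b0 A0) (b0 B0) (b1 A1) (eps ori s0 c A0) (eps ori s0 c B0) (eps ori s1 c A1)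
      else if A1 \<noteq> B1 then
       (if is_proj D A1 then D_PV else if is_proj D B1 then D_VP else D_VV)
        (b0 A0) (b1 A1) (b1 B1) (eps ori s0 c A0) (eps ori s1 c A1) (eps ori s1 c B1)
      else 0)"

lemma coef_local_coefP: "coef D ori fori ordr c s0 b0 b1 = (if \<forall>C \<in> rest c s0. b1 C = b0 C
     then edge_sign c s0 * (\<Prod>C | C \<in> rest c s0 \<and> b0 C. agree_sign s0 s1 C) * local_coefP b0 b1 else 0)"
proof -
  have r: "set (filter (\<lambda>C. C \<noteq> A0 \<and> C \<noteq> B0) (ordr s0)) = rest c s0"
    using set_ordr[OF s0(1)] by (auto simp: rest_def)
  have p: "(\<Prod>C \<in> rest c s0. if b0 C \<and> \<not> agree ori fori s0 s1 C then -1 else 1) =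
     (\<Prod>C | C \<in> rest c s0 \<and> b0 C. agree_sign s0 s1 C)"
    unfolding agree_sign_def by (subst prod.inter_filter[OF finite_rest]) (auto intro!: prod.cong)
  show ?thesis
    unfolding coef_def edge_sign_def local_coefP_def s1_def[symmetric] Let_def r p by simp
qed

text \<open>The projective formulas differ from those on V exactly by dropping the terms in which
  the projective circle changes from 1 to X. No term changes it from X to 1, so those on V respect
  the filtration.\<close>

lemma local_coef_plab:
  assumes "\<forall>C \<in> rest c s0. b1 C = b0 C"
  shows "local_coefP b0 b1 = (if plab s0 b0 = plab s1 b1 then local_coef c s0 b0 b1 else 0)"
    and "local_coef c s0 b0 b1 \<noteq> 0 \<Longrightarrow> plab s0 b0 \<Longrightarrow> plab s1 b1"
proof -
  have "local_coefP b0 b1 = (if plab s0 b0 = plab s1 b1 then local_coef c s0 b0 b1 else 0) \<and>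
    (local_coef c s0 b0 b1 \<noteq> 0 \<longrightarrow> plab s0 b0 \<longrightarrow> plab s1 b1)"
  proof (cases "\<exists>C \<in> rest c s0. is_proj D C")
    case True
    then obtain C where C: "C \<in> rest c s0" "is_proj D C" by auto
    then have 01: "C \<in> circles D s0" "C \<in> circles D s1" by (simp add: rest_def) (use C in \<open>simp add: rest_s1\<close>)
    have "plab s0 b0 = plab s1 b1" using plab_eq[OF s0(1) 01(1) C(2)] plab_eq[OF s1 01(2) C(2)] assms C by auto
    moreover have "\<not> is_proj D A0" "\<not> is_proj D B0" "\<not> is_proj D A1" "\<not> is_proj D B1"
      using proj_unique[OF s0(1) 01(1) C(2)] proj_unique[OF s1 01(2) C(2)] C(1) AB_rest AB_circles by metis+
    ultimately show ?thesis by (simp add: local_coefP_def local_coef_eq)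
  next
    case False
    have n0: "\<not> plab s0 b0" if "\<not> is_proj D A0" "\<not> is_proj D B0"
      using that False by (auto simp: plab_def rest_def)
    have n1: "\<not> plab s1 b1" if "\<not> is_proj D A1" "\<not> is_proj D B1"
      using that False by (auto simp: plab_def rest_s1)
    note P = plab_eq[OF s0(1) AB_circles(1)] plab_eq[OF s0(1) AB_circles(2)]
      plab_eq[OF s1 AB_circles(3)] plab_eq[OF s1 AB_circles(4)]
    show ?thesis
    proof (cases rule: bifurcation_cases)
      case one_one
      then show ?thesis by (simp add: local_coefP_def local_coef_eq)
    next
      case merge
      have u: "\<not> (is_proj D A0 \<and> is_proj D B0)"
        using proj_unique[OF s0(1) AB_circles(1) _ AB_circles(2)] merge by auto
      consider "is_proj D A0" | "is_proj D B0" "\<not> is_proj D A0" | "\<not> is_proj D A0" "\<not> is_proj D B0" by blast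
      then show ?thesis
      proof cases
        case 1
        then have "is_proj D A1" using proj_merge merge u by auto
        then show ?thesis using 1 P merge by (auto simp: local_coefP_def local_coef_eq m_PV_def m_VV_def)
      next
        case 2
        then have "is_proj D A1" using proj_merge merge u by auto
        then show ?thesis using 2 P merge by (auto simp: local_coefP_def local_coef_eq m_VP_def m_VV_def)
      next
        case 3
        then have "\<not> is_proj D A1" using proj_merge merge by auto
        then show ?thesis using 3 n0 n1 merge by (simp add: local_coefP_def local_coef_eq)
      qed
    next
      case split
      have u: "\<not> (is_proj D A1 \<and> is_proj D B1)"
        using proj_unique[OF s1 AB_circles(3) _ AB_circles(4)] split by auto
      consider "is_proj D A1" | "is_proj D B1" "\<not> is_proj D A1" | "\<not> is_proj D A1" "\<not> is_proj D B1" by blast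
      then show ?thesis
      proof cases
        case 1
        then have "is_proj D A0" using proj_split split u by auto
        then have "plab s0 b0 = b0 A0" "plab s1 b1 = b1 A1" using P 1 by auto
        then show ?thesis using 1 split(2) by (auto simp: local_coefP_def local_coef_eq split(1) D_PV_def D_VV_def)
      next
        case 2
        then have "is_proj D A0" using proj_split split u by auto
        then have "plab s0 b0 = b0 A0" "plab s1 b1 = b1 B1" using P 2 by auto
        then show ?thesis using 2 split(2) by (auto simp: local_coefP_def local_coef_eq split(1) D_VP_def D_VV_def)
      next
        case 3
        then have "\<not> is_proj D A0" using proj_split split by auto
        then show ?thesis using 3 n0 n1 split by (simp add: local_coefP_def local_coef_eq)
      qed
    qed
  qed
  then show "local_coefP b0 b1 = (if plab s0 b0 = plab s1 b1 then local_coef c s0 b0 b1 else 0)"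
    "local_coef c s0 b0 b1 \<noteq> 0 \<Longrightarrow> plab s0 b0 \<Longrightarrow> plab s1 b1" by auto
qed

lemma coef_plab: "coef D ori fori ordr c s0 b0 b1 = (if plab s0 b0 = plab s1 b1 then coefV c s0 b0 b1 else 0)"
  unfolding coef_local_coefP coefV_eq using local_coef_plab(1)[of b1 b0] by auto

lemma coefV_plab: "coefV c s0 b0 b1 \<noteq> 0 \<Longrightarrow> plab s0 b0 \<Longrightarrow> plab s1 b1"
  unfolding coefV_eq using local_coef_plab(2)[of b1 b0] by (auto split: if_splits)

end

context proj_pdiag
begin

lemma proj_crossing:
  assumes "c \<in> Xs D" "s \<in> states D" "\<not> s c"
  shows "proj_crossing D ori ordr c s (s(c := True))"
proof -
  interpret framed_crossing D ori fori ordr c s "s(c := True)"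
    by (rule framed_crossing) fact+
  show ?thesis by unfold_locales
qed

text \<open>If a path has equal level at both ends, and neither step can turn \<open>True\<close>
  into \<open>False\<close>, then both steps preserve it. Hence the degree zero part of the
  composite is the composite of the degree zero parts.\<close>

lemma coef_comp:
  assumes cd: "c \<in> Xs D" "d \<in> Xs D" "c \<noteq> d" and st: "s \<in> states D" "\<not> s c" "\<not> s d"
  shows "(\<Sum>b1 \<in> labelings D (s(c := True)). coef D ori fori ordr c s b0 b1 * coef D ori fori ordr d (s(c := True)) b1 b2) =
    (if plab s b0 = plab (s(c := True, d := True)) b2 then face_coef c d s b0 b2 else 0)"
proof -
  interpret E1: proj_crossing D ori fori ordr c s "s(c := True)"
    by (rule proj_crossing) fact+
  have s1: "s(c := True) \<in> states D" "\<not> (s(c := True)) d" using cd st by (auto simp: states_def)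
  interpret E2: proj_crossing D ori fori ordr d "s(c := True)" "s(c := True, d := True)"
    by (rule proj_crossing) fact+
  have "coef D ori fori ordr c s b0 b1 * coef D ori fori ordr d (s(c := True)) b1 b2 =
     (if plab s b0 = plab (s(c := True, d := True)) b2 then coefV c s b0 b1 * coefV d (s(c := True)) b1 b2 else 0)" for b1
    unfolding E1.coef_plab E2.coef_plab using E1.coefV_plab[of b0 b1] E2.coefV_plab[of b1 b2] by auto
  then show ?thesis unfolding face_coef_def by simp
qed

end

section \<open>Reduction of a face to its matching\<close>

text \<open>Replacing \<open>r\<close> by \<open>r'\<close> costs the same sign in the source and in
  the target, so it cancels. What is left is one factor for each reordered end.\<close>

lemma perm_sign_change:
  assumes "distinct o0" "distinct K0" "distinct (u @ r)" "distinct (u @ r')" "set o0 = set K0" "set K0 = set (u @ r)"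
    and "distinct o1" "distinct K1" "distinct (v @ r)" "distinct (v @ r')" "set o1 = set K1" "set K1 = set (v @ r)"
    and "set r = set r'"
  shows "perm_sign o0 (u @ r) * perm_sign (v @ r) o1 =
    perm_sign o0 K0 * perm_sign o1 K1 * (perm_sign K0 (u @ r') * perm_sign (v @ r') K1)"
proof -
  have "perm_sign o0 (u @ r) = perm_sign o0 K0 * (perm_sign K0 (u @ r') * perm_sign (u @ r') (u @ r))"
    using assms by (simp add: perm_sign_mult)
  also have "perm_sign (u @ r') (u @ r) = perm_sign r' r"
    using assms by (intro perm_sign_append_left) auto
  finally have 1: "perm_sign o0 (u @ r) = perm_sign o0 K0 * perm_sign K0 (u @ r') * perm_sign r' r" by simp
  have "perm_sign (v @ r) o1 = perm_sign (v @ r) (v @ r') * (perm_sign (v @ r') K1 * perm_sign K1 o1)"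
    using assms by (simp add: perm_sign_mult)
  also have "perm_sign (v @ r) (v @ r') = perm_sign r r'"
    using assms by (intro perm_sign_append_left) auto
  also have "perm_sign r r' = perm_sign r' r"
    using assms by (intro perm_sign_sym) auto
  also have "perm_sign K1 o1 = perm_sign o1 K1"
    using assms by (intro perm_sign_sym) auto
  finally have 2: "perm_sign (v @ r) o1 = perm_sign r' r * perm_sign (v @ r') K1 * perm_sign o1 K1" by simp
  have "z * perm_sign r' r * (perm_sign r' r * y) = z * y" for z y
    using perm_sign_square[of r' r] by (metis mult.assoc mult.left_neutral)
  then show ?thesis unfolding 1 2 by (simp add: mult.assoc mult.left_commute mult.commute)
qed

lemma perm_sign_local:
  assumes "inj_on f (set xs)" "distinct xs" "distinct ys" "set xs = set ys" "distinct N" "set N \<inter> f ` set xs = {}"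
  shows "perm_sign (map f xs @ N) (map f ys @ N) = bsgn (even_perm xs ys)"
proof -
  have "perm_sign (map f xs @ N) (map f ys @ N) = perm_sign (map f xs) (map f ys)"
    using assms by (intro perm_sign_append_right) (auto simp: distinct_map)
  also have "\<dots> = perm_sign xs ys" using assms by (intro perm_sign_map) auto
  also have "\<dots> = bsgn (even_perm xs ys)"
    unfolding bsgn_def using assms by (intro perm_sign_even_perm) auto
  finally show ?thesis .
qed

definition faithful :: "table \<Rightarrow> (endpt \<Rightarrow> 'b) \<Rightarrow> bool" where
  "faithful T f \<longleftrightarrow> (\<forall>p q. rep T p = rep T q \<longleftrightarrow> f p = f q) \<and> (\<forall>p. rep T (rep T p) = rep T p)"

context
  fixes T :: table and f :: "endpt \<Rightarrow> 'b"
  assumes T: "faithful T f"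
begin

lemma rep_eq_iff: "rep T p = rep T q \<longleftrightarrow> f p = f q" and rep_rep: "rep T (rep T p) = rep T p"
  using T unfolding faithful_def by blast+

lemma f_rep: "f (rep T p) = f p"
  using rep_eq_iff rep_rep by blast

lemma rep_reps: "rep T p \<in> set (reps T)"
  by (simp add: reps_def set_endpts rep_rep)

lemma inj_reps: "inj_on f (set (reps T))"
proof (rule inj_onI)
  fix p q assume "p \<in> set (reps T)" "q \<in> set (reps T)" "f p = f q"
  then show "p = q" using rep_eq_iff[of p q] by (simp add: reps_def)
qed

lemma f_reps: "f ` set (reps T) = range f"
  using rep_reps f_rep by (metis (no_types, lifting) image_eqI image_subsetI subset_antisym rangeI rangeE subsetI)

end

lemma distinct_reps: "distinct (reps T)"
  by (simp add: reps_def distinct_endpts)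

context framed_crossing
begin

text \<open>A circle through \<open>c\<close> uses NW or SE in either smoothing, so a circle missing
  \<open>P\<close> misses \<open>c\<close> and survives. Taking the half-edges at both crossings of
  a face as \<open>P\<close> gives one common set of far circles for its four corners.\<close>

lemma circles_away:
  assumes "P \<subseteq> halfs D" "(c, NW) \<in> P" "(c, SE) \<in> P"
  shows "circles D s0 - circ_of D s0 ` P = circles D s1 - circ_of D s1 ` P"
proof -
  have "C \<in> circ_of D s0 ` P \<longleftrightarrow> C \<in> circ_of D s1 ` P" if "C \<in> rest c s0" for C
  proof
    assume "C \<in> circ_of D s0 ` P"
    then obtain h where h: "h \<in> P" "C = circ_of D s0 h" by auto
    then have "h \<in> halfs D" using assms by auto
    then show "C \<in> circ_of D s1 ` P"
      by (rule circ_touch) (use h that image_eqI[OF _ h(1), of C "circ_of D s1"] in \<open>auto simp: rest_def\<close>)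
  next
    assume "C \<in> circ_of D s1 ` P"
    then obtain h where h: "h \<in> P" "C = circ_of D s1 h" by auto
    then have "h \<in> halfs D" using assms by auto
    then show "C \<in> circ_of D s0 ` P"
      by (rule circ_touch) (use h that image_eqI[OF _ h(1), of C "circ_of D s0"] in \<open>auto simp: rest_s1\<close>)
  qed
  moreover have "circles D s0 - circ_of D s0 ` P = rest c s0 - circ_of D s0 ` P"
    unfolding rest_def using assms(2,3) by auto
  moreover have "circles D s1 - circ_of D s1 ` P = rest c s0 - circ_of D s1 ` P"
    unfolding rest_s1 using assms(2,3) by auto
  ultimately show ?thesis by auto
qed

text \<open>Each ordering contributes a factor attached to its state: the comparison with
  representatives followed by \<open>N\<close>. Along the two composites of a face the factors of
  the middle states square to 1 and those of the ends are common, leaving the signs computed in the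
  tables.\<close>

lemma edge_sign_local:
  fixes f0 f1 :: "endpt \<Rightarrow> 'c circ"
  assumes T0: "faithful T0 f0" and T1: "faithful T1 f1" and ok: "lists_ok x T0 T1"
    and N: "distinct N" "set N = circles D s0 - range f0" "set N = circles D s1 - range f1"
    and sub: "range f0 \<subseteq> circles D s0" "range f1 \<subseteq> circles D s1"
    and f: "f0 (x, NW) = A0" "f0 (x, SE) = B0" "f1 (x, NW) = A1" "f1 (x, SE) = B1"
    and same: "\<And>p. f0 p \<notin> {A0, B0} \<Longrightarrow> f1 p = f0 p"
  shows "edge_sign c s0 = perm_sign (ordr s0) (map f0 (reps T0) @ N) * perm_sign (ordr s1) (map f1 (reps T1) @ N) * kval (edge_kind x T0 T1)"
    and "edge_kind x T0 T1 \<noteq> One_One \<Longrightarrow> is_Split (edge_kind x T0 T1) \<longleftrightarrow> splits c s0"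
proof -
  let ?R0 = "reps T0" and ?R1 = "reps T1"
  let ?a0 = "rep T0 (x, NW)" and ?b0 = "rep T0 (x, SE)" and ?a1 = "rep T1 (x, NW)" and ?b1 = "rep T1 (x, SE)"
  let ?l = "rest_reps x T0"
  let ?r = "filter (\<lambda>C. C \<noteq> A0 \<and> C \<noteq> B0) (ordr s0)" and ?r' = "map f0 ?l @ N"
  let ?K0 = "map f0 ?R0 @ N" and ?K1 = "map f1 ?R1 @ N"
  have ab: "?a0 = ?b0 \<longleftrightarrow> A0 = B0" "?a1 = ?b1 \<longleftrightarrow> A1 = B1"
    by (simp_all add: rep_eq_iff[OF T0] rep_eq_iff[OF T1] f)
  have fab: "f0 ?a0 = A0" "f0 ?b0 = B0" "f1 ?a1 = A1" "f1 ?b1 = B1"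
    using f_rep[OF T0] f_rep[OF T1] f by auto
  have l: "set ?l = set ?R0 - {?a0, ?b0}" "distinct ?l"
    by (auto simp: rest_reps_def distinct_reps)
  have fl: "f0 p \<notin> {A0, B0}" if "p \<in> set ?l" for p
  proof -
    have "p \<in> set ?R0" "p \<noteq> ?a0" "p \<noteq> ?b0" using that l by auto
    then have "f0 p \<noteq> f0 ?a0" "f0 p \<noteq> f0 ?b0"
      using inj_on_eq_iff[OF inj_reps[OF T0] _ rep_reps[OF T0]] by simp_all
    then show ?thesis using fab by auto
  qed
  have f01: "map f0 ?l = map f1 ?l" using same fl by (intro map_cong) auto
  have inj_l: "inj_on f0 (set ?l)" using inj_reps[OF T0] l by (auto intro: inj_on_subset)
  have dK: "distinct ?K0" "distinct ?K1"
    using N inj_reps[OF T0] inj_reps[OF T1] f_reps[OF T0] f_reps[OF T1] by (auto simp: distinct_map distinct_reps)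
  have sK: "set ?K0 = circles D s0" "set ?K1 = circles D s1"
    using N sub f_reps[OF T0] f_reps[OF T1] by auto
  have r: "set ?r = rest c s0" "distinct ?r"
    using set_ordr[OF s0(1)] distinct_ordr[OF s0(1)] by (auto simp: rest_def)
  have dr': "distinct ?r'" using l inj_l N by (auto simp: distinct_map)
  have fimg: "f0 ` set ?l = range f0 - {A0, B0}"
    using inj_on_image_set_diff[OF inj_reps[OF T0], of "set ?R0" "{?a0, ?b0}"] l rep_reps[OF T0] fab f_reps[OF T0]
    by auto
  have sr: "set ?r = set ?r'"
    unfolding r(1) rest_def using N(2) sub(1) fimg rangeI[of f0 "(x, NW)"] rangeI[of f0 "(x, SE)"]
    unfolding f by auto
  have set_l1: "set (?a1 # ?b1 # ?l) = set ?R1" using ok by (simp add: lists_ok_def)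
  have al: "?a1 \<notin> set ?l" "?b1 \<notin> set ?l"
  proof -
    have "f1 p \<in> rest c s0" if "p \<in> set ?l" for p
      using fl[OF that] same[of p] sub(1) by (auto simp: rest_def)
    then show "?a1 \<notin> set ?l" "?b1 \<notin> set ?l" using fab AB_rest by metis+
  qed
  have o: "distinct (ordr s0)" "distinct (ordr s1)" "set (ordr s0) = set ?K0" "set (ordr s1) = set ?K1"
    using distinct_ordr set_ordr s0 s1 sK by auto
  have ps0: "perm_sign ?K0 (map f0 (u @ ?l) @ N) = bsgn (even_perm ?R0 (u @ ?l))"
    if "distinct (u @ ?l)" "set (u @ ?l) = set ?R0" for u
    by (rule perm_sign_local) (use that N(1,2) f_reps[OF T0] inj_reps[OF T0] distinct_reps in auto)
  have ps1: "perm_sign (map f1 (v @ ?l) @ N) ?K1 = bsgn (even_perm (v @ ?l) ?R1)"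
    if v: "distinct (v @ ?l)" "set (v @ ?l) = set ?R1" for v
  proof (rule perm_sign_local)
    show "inj_on f1 (set (v @ ?l))" unfolding v(2) by (rule inj_reps[OF T1])
    show "set N \<inter> f1 ` set (v @ ?l) = {}" unfolding v(2) f_reps[OF T1] using N(3) by auto
  qed (use v N(1) distinct_reps in auto)
  \<comment> \<open>\<open>u\<close> and \<open>v\<close> hold the circles that meet the
    bifurcation, two then one for a merge and one then two for a split, so both cases are
    instances.\<close>
  have main: "perm_sign (ordr s0) (map f0 u @ ?r) * perm_sign (map f1 v @ ?r) (ordr s1) =
      perm_sign (ordr s0) ?K0 * perm_sign (ordr s1) ?K1 * bsgn (even_perm ?R0 (u @ ?l) = even_perm (v @ ?l) ?R1)"
    if u: "distinct (u @ ?l)" "set (u @ ?l) = set ?R0" and v: "distinct (v @ ?l)" "set (v @ ?l) = set ?R1" for u v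
  proof -
    have "distinct (map f0 (u @ ?l) @ N)"
      unfolding distinct_append[of "map f0 _"] distinct_map set_map u(2) f_reps[OF T0]
      using u(1) N inj_reps[OF T0] by auto
    moreover have "set (map f0 (u @ ?l) @ N) = set ?K0" unfolding set_append[of "map f0 _"] set_map u(2) ..
    ultimately have du: "distinct (map f0 u @ ?r')" "set ?K0 = set (map f0 u @ ?r')" by simp_all
    have "distinct (map f1 (v @ ?l) @ N)"
      unfolding distinct_append[of "map f1 _"] distinct_map set_map v(2) f_reps[OF T1]
      using v(1) N(1,3) inj_reps[OF T1] by auto
    moreover have "set (map f1 (v @ ?l) @ N) = set ?K1" unfolding set_append[of "map f1 _"] set_map v(2) ..
    ultimately have dv: "distinct (map f1 v @ ?r')" "set ?K1 = set (map f1 v @ ?r')" by (simp_all add: f01)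
    have "perm_sign (ordr s0) (map f0 u @ ?r) * perm_sign (map f1 v @ ?r) (ordr s1) =
      perm_sign (ordr s0) ?K0 * perm_sign (ordr s1) ?K1 *
      (perm_sign ?K0 (map f0 u @ ?r') * perm_sign (map f1 v @ ?r') ?K1)"
    proof (rule perm_sign_change[OF o(1) dK(1) _ du(1) o(3) _ o(2) dK(2) _ dv(1) o(4) _ sr])
      show "distinct (map f0 u @ ?r)" "distinct (map f1 v @ ?r)"
        using du(1) dv(1) r(2) unfolding distinct_append sr by blast+
      show "set ?K0 = set (map f0 u @ ?r)" "set ?K1 = set (map f1 v @ ?r)"
        using du(2) dv(2) unfolding set_append sr by blast+
    qed
    also have "perm_sign ?K0 (map f0 u @ ?r') = bsgn (even_perm ?R0 (u @ ?l))"
      using ps0[OF u] by simp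
    also have "perm_sign (map f1 v @ ?r') ?K1 = bsgn (even_perm (v @ ?l) ?R1)"
      using ps1[OF v] by (simp add: f01)
    finally show ?thesis by (simp add: bsgn_eq)
  qed
  have sl0: "set (?a0 # ?b0 # ?l) = set ?R0" using l rep_reps[OF T0] by auto
  have l0: "?a0 \<notin> set ?l" "?b0 \<notin> set ?l" using l by auto
  have "edge_sign c s0 = perm_sign (ordr s0) ?K0 * perm_sign (ordr s1) ?K1 * kval (edge_kind x T0 T1) \<and>
    (edge_kind x T0 T1 \<noteq> One_One \<longrightarrow> is_Split (edge_kind x T0 T1) = splits c s0)"
  proof (cases rule: bifurcation_cases)
    case one_one
    then show ?thesis using ab by (simp add: edge_sign_one_one one_to_one_def edge_kind_def edge_kind_aux_def)
  next
    case merge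
    have "edge_sign c s0 = perm_sign (ordr s0) (map f0 [?a0, ?b0] @ ?r) * perm_sign (map f1 [?a1] @ ?r) (ordr s1)"
      unfolding edge_sign_def s1_def[symmetric] Let_def using merge(1) fab by simp
    also have "\<dots> = perm_sign (ordr s0) ?K0 * perm_sign (ordr s1) ?K1 *
        bsgn (even_perm ?R0 ([?a0, ?b0] @ ?l) = even_perm ([?a1] @ ?l) ?R1)"
      by (rule main) (use merge ab l l0 al sl0 set_l1 in auto)
    finally show ?thesis using merge ab by (simp add: edge_kind_def edge_kind_aux_def splits_def)
  next
    case split
    have "edge_sign c s0 = perm_sign (ordr s0) (map f0 [?a0] @ ?r) * perm_sign (map f1 [?a1, ?b1] @ ?r) (ordr s1)"
      unfolding edge_sign_def s1_def[symmetric] Let_def using split(1,2) fab by simp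
    also have "\<dots> = perm_sign (ordr s0) ?K0 * perm_sign (ordr s1) ?K1 *
        bsgn (even_perm ?R0 ([?a0] @ ?l) = even_perm ([?a1, ?b1] @ ?l) ?R1)"
      by (rule main) (use split(1,2) ab l l0 al sl0 set_l1 in auto)
    finally show ?thesis using split(1,2) ab by (simp add: edge_kind_def edge_kind_aux_def splits_def)
  qed
  then show "edge_sign c s0 = perm_sign (ordr s0) ?K0 * perm_sign (ordr s1) ?K1 * kval (edge_kind x T0 T1)"
    "edge_kind x T0 T1 \<noteq> One_One \<Longrightarrow> is_Split (edge_kind x T0 T1) \<longleftrightarrow> splits c s0" by auto
qed

end

section \<open>The four corners of a face and their common matching\<close>

context face
begin

definition crossing_at :: "bool \<Rightarrow> 'c" where "crossing_at x = (if x then d else c)"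

text \<open>It conjugates the vertical to the horizontal smoothing while fixing NW and SE, so the
  convention for the first factor is unaffected.\<close>

definition swapq :: "quad \<Rightarrow> quad" where
  "swapq q = (case q of NE \<Rightarrow> SW | SW \<Rightarrow> NE | q \<Rightarrow> q)"

text \<open>Exchanging NE and SW at negative crossings makes smoothing False vertical everywhere.\<close>

definition half_of :: "endpt \<Rightarrow> 'c \<times> quad" where
  "half_of p = (crossing_at (fst p), if ovr D (crossing_at (fst p)) then snd p else swapq (snd p))"

definition face_state :: "bool \<Rightarrow> bool \<Rightarrow> 'c \<Rightarrow> bool" where
  "face_state tc td = s(c := tc, d := td)"

lemma half_of_NW [simp]: "half_of (x, NW) = (crossing_at x, NW)" and half_of_SE [simp]: "half_of (x, SE) = (crossing_at x, SE)"
  by (simp_all add: half_of_def swapq_def)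

lemma crossing_at_eq: "crossing_at x = crossing_at y \<longleftrightarrow> x = y" using cd by (simp add: crossing_at_def)

lemma swapq_swapq [simp]: "swapq (swapq q) = q" by (cases q) (simp_all add: swapq_def)

lemma half_of_eq: "half_of p = half_of q \<longleftrightarrow> p = q"
proof
  assume h: "half_of p = half_of q"
  then have "fst p = fst q" by (simp add: half_of_def crossing_at_eq)
  moreover from h this have "snd p = snd q" by (simp add: half_of_def split: if_splits) (metis swapq_swapq)
  ultimately show "p = q" by (simp add: prod_eq_iff)
qed simp

lemma half_of_surj:
  assumes "fst h \<in> {c, d}" obtains p where "h = half_of p"
proof -
  obtain x where x: "fst h = crossing_at x" using assms by (metis (full_types) crossing_at_def insertE singletonD)
  have "h = half_of (x, if ovr D (crossing_at x) then snd h else swapq (snd h))"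
    using x by (simp add: half_of_def prod_eq_iff)
  then show ?thesis by (rule that)
qed

lemma fst_half_of: "fst (half_of p) \<in> {c, d}" by (simp add: half_of_def crossing_at_def)

lemma half_of_halfs: "half_of p \<in> halfs D" using cd by (simp add: halfs_iff half_of_def crossing_at_def)

lemma flip_swapq: "hflip (swapq q) = swapq (vflip q)" "vflip (swapq q) = swapq (hflip q)"
  by (cases q; simp add: swapq_def)+

lemma sm_half_of: "sm D (face_state tc td) (half_of p) = half_of (smooth_endpt tc td p)"
  using cd by (cases p) (auto simp: sm_def half_of_def face_state_def crossing_at_def flip_swapq)

lemma face_state_states: "face_state tc td \<in> states D" using cd st by (auto simp: face_state_def states_def)

lemma face_state_outside: "outside D {c, d} (face_state tc td) = outside D {c, d} s"
  by (rule outside_cong) (auto simp: face_state_def)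

lemma s_states: "s \<in> states D" by (rule st(1))

definition outer_endpt :: "endpt \<Rightarrow> endpt" where
  "outer_endpt p = (THE q. half_of q = outer {c, d} s (half_of p))"

lemma half_of_outer_endpt: "half_of (outer_endpt p) = outer {c, d} s (half_of p)"
proof -
  obtain q where "outer {c, d} s (half_of p) = half_of q"
    using half_of_surj outer_K[OF s_states half_of_halfs fst_half_of] by metis
  then show ?thesis unfolding outer_endpt_def using half_of_eq by (metis (mono_tags, lifting) theI)
qed

definition endpt_circ :: "bool \<Rightarrow> bool \<Rightarrow> endpt \<Rightarrow> 'c circ" where
  "endpt_circ tc td p = circ_of D (face_state tc td) (half_of p)"

lemma ex_matching:
  obtains m where "matching_ok m" "\<And>p. look m p = outer_endpt p"
proof -
  have "\<exists>m \<in> set (matchings 4 endpts). \<forall>p \<in> set endpts. look m p = outer_endpt p"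
  proof (rule matchings_complete)
    fix p
    have "half_of (outer_endpt p) \<noteq> half_of p"
      unfolding half_of_outer_endpt by (rule outer_neq[OF s_states half_of_halfs fst_half_of])
    moreover have "half_of (outer_endpt (outer_endpt p)) = half_of p"
      unfolding half_of_outer_endpt by (rule outer_outer[OF s_states half_of_halfs fst_half_of])
    ultimately show "outer_endpt p \<in> set endpts \<and> outer_endpt p \<noteq> p \<and> outer_endpt (outer_endpt p) = p"
      by (auto simp: set_endpts half_of_eq)
  qed (simp_all add: endpts_def)
  then show ?thesis using that matchings_ok by (auto simp: set_endpts)
qed

text \<open>The four states agree away from \<open>c\<close> and \<open>d\<close>, so one matching
  describes the outside of all of them. Together with the smoothing arcs at the two crossings it
  accounts for all connections within a circle, by \<open>circ_rel_near\<close>.\<close>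

lemma endpt_map_st:
  assumes m: "\<And>p. look m p = outer_endpt p" and cl: "closed_table m tc td (table m tc td)"
  shows "endpt_map m tc td (endpt_circ tc td) (\<lambda>p. ori (face_state tc td) (half_of p))"
proof
  let ?t = "face_state tc td"
  note o = s_states half_of_halfs fst_half_of
  have agr: "s x = ?t x" if "x \<notin> {c, d}" for x using that by (simp add: face_state_def)
  have mu: "outer {c, d} ?t = outer {c, d} s" by (simp add: outer_def fun_eq_iff face_state_outside)
  fix p q
  have "(half_of p, half_of (look m p)) \<in> circ_rel D ?t"
    unfolding m half_of_outer_endpt using outer_outside[OF o] outside_mono[of D "{c, d}" ?t]
    unfolding face_state_outside by blast
  then show "endpt_circ tc td (look m p) = endpt_circ tc td p"
    unfolding endpt_circ_def using circ_of_eq_iff[OF half_of_halfs] by metis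
  have "(half_of p, sm D ?t (half_of p)) \<in> circ_rel D ?t"
    unfolding circ_rel_outside by (rule outside_sm[OF half_of_halfs]) simp
  then show "endpt_circ tc td (smooth_endpt tc td p) = endpt_circ tc td p"
    unfolding endpt_circ_def sm_half_of using circ_of_eq_iff[OF half_of_halfs] by metis
  show "ori ?t (half_of (look m p)) \<longleftrightarrow> \<not> ori ?t (half_of p)"
    unfolding m half_of_outer_endpt by (rule outer_ori[OF o face_state_states]) (rule agr)
  show "ori ?t (half_of (smooth_endpt tc td p)) \<longleftrightarrow> \<not> ori ?t (half_of p)"
    unfolding sm_half_of[symmetric] by (rule ori_sm[OF face_state_states half_of_halfs])
  assume "endpt_circ tc td p = endpt_circ tc td q"
  then have "(half_of p, half_of q) \<in> circ_rel D ?t" unfolding endpt_circ_def using circ_of_eq_iff[OF half_of_halfs] by metis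
  then have n: "(half_of p, half_of q) \<in> near {c, d} ?t"
    by (rule circ_rel_near[OF face_state_states half_of_halfs fst_half_of _ fst_half_of])
  have "\<exists>q. y = half_of q \<and> (p, q) \<in> {(x, y). y = look m x \<or> y = smooth_endpt tc td x}\<^sup>*"
    if "(half_of p, y) \<in> near {c, d} ?t" for y
    using that unfolding near_def
  proof (induction rule: rtrancl_induct)
    case (step y z)
    then obtain q where q: "y = half_of q" "(p, q) \<in> {(x, y). y = look m x \<or> y = smooth_endpt tc td x}\<^sup>*" by blast
    from step(2) have "z = half_of (look m q) \<or> z = half_of (smooth_endpt tc td q)"
      unfolding q(1) by (auto simp: mu m half_of_outer_endpt sm_half_of)
    then obtain r where "z = half_of r" "r = look m q \<or> r = smooth_endpt tc td q" by blast
    then show ?case using q(2) by (intro exI[of _ r]) (auto intro: rtrancl_into_rtrancl)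
  qed blast
  from this[OF n] show "(p, q) \<in> {(x, y). y = look m x \<or> y = smooth_endpt tc td x}\<^sup>*"
    by (auto simp: half_of_eq)
qed (rule cl)

lemma pair_pure:
  assumes "pure_sign e e' = Some (k, b)"
  shows "kval e * kval e' = bsgn b" "is_Split e = k" "is_Split e' = k"
  using assms by (cases e; cases e'; auto simp: bsgn_eq)+

lemma pair_mixed:
  assumes "pure_sign e e' = None"
    and y: "\<And>x q. q = NW \<or> q = SE \<Longrightarrow> mulX t (crossing_at x, q) unit_chain b = bsgn (rep_sign T (x, q)) * y (rep T (x, q))"
  shows "kval e * kval e' * mulE t (crossing_at x) (is_Split e) (mulE t (crossing_at (\<not> x)) (is_Split e') unit_chain) b =
    (\<Sum>(r, v) \<leftarrow> mixed_terms T x e e'. bsgn v * y r)"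
proof -
  have E: "mulE t c' True g = (\<lambda>b. mulX t (c', NW) g b + mulX t (c', SE) g b)" "mulE t c' False g = g" for c' g
    by (auto simp: mulE_def)
  show ?thesis using assms(1)
    by (cases e; cases e') (simp_all add: E y split_terms_def bsgn_eq algebra_simps)
qed

lemma face_sum:
  assumes ok: "face_ok T e1 e2 e3 e4"
    and y: "\<And>x q. q = NW \<or> q = SE \<Longrightarrow> mulX t (crossing_at x, q) unit_chain b = bsgn (rep_sign T (x, q)) * y (rep T (x, q))"
  shows "kval e1 * kval e2 * mulE t c (is_Split e1) (mulE t d (is_Split e2) unit_chain) b +
    kval e3 * kval e4 * mulE t d (is_Split e3) (mulE t c (is_Split e4) unit_chain) b = 0"
proof (cases "pure_sign e1 e2")
  case None
  then have n: "pure_sign e3 e4 = None" "cancel 4 (mixed_terms T False e1 e2 @ mixed_terms T True e3 e4)"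
    using ok by (auto simp: face_ok_def split: option.splits)
  have y': "mulX t (crossing_at x, q) unit_chain b = bsgn (rep_sign T (x, q)) * y (rep T (x, q))" if "q = NW \<or> q = SE" for x q
    by (rule y[OF that])
  show ?thesis
    using pair_mixed[where x = False and T = T and y = y, OF None y'] pair_mixed[where x = True and T = T and y = y, OF n(1) y']
      cancel_sum[OF n(2), of y] by (simp add: crossing_at_def)
next
  case (Some kb)
  then obtain k b1 where 1: "pure_sign e1 e2 = Some (k, b1)" by (cases kb) auto
  then have 2: "pure_sign e3 e4 = Some (k, \<not> b1)"
    using ok by (auto simp: face_ok_def split: option.splits prod.splits)
  show ?thesis
    unfolding pair_pure[OF 1] pair_pure[OF 2] by (simp add: mulE_commute[of t d])
qed

lemma edge_sign_edge:
  assumes "framed_crossing D ori ordr (crossing_at x) (face_state tc td) (face_state tc' td')"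
    and T: "faithful T (endpt_circ tc td)" "faithful T' (endpt_circ tc' td')" "lists_ok x T T'"
    and N: "distinct N" "set N = circles D (face_state tc td) - range (endpt_circ tc td)"
      "set N = circles D (face_state tc' td') - range (endpt_circ tc' td')"
  shows "edge_sign (crossing_at x) (face_state tc td) = perm_sign (ordr (face_state tc td)) (map (endpt_circ tc td) (reps T) @ N) *
      perm_sign (ordr (face_state tc' td')) (map (endpt_circ tc' td') (reps T') @ N) * kval (edge_kind x T T')"
    and "edge_kind x T T' \<noteq> One_One \<Longrightarrow> is_Split (edge_kind x T T') \<longleftrightarrow> splits (crossing_at x) (face_state tc td)"
proof -
  interpret framed_crossing D ori fori ordr "crossing_at x" "face_state tc td" "face_state tc' td'" by fact
  have sub: "range (endpt_circ tc td) \<subseteq> circles D (face_state tc td)" for tc td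
    using half_of_halfs by (auto simp: endpt_circ_def circ_of_circles)
  have same: "endpt_circ tc' td' p = endpt_circ tc td p" if "endpt_circ tc td p \<notin> {A0, B0}" for p
    using that half_of_halfs[of p] unfolding endpt_circ_def by (rule_tac circ_touch) auto
  have f: "endpt_circ tc td (x, NW) = A0" "endpt_circ tc td (x, SE) = B0" "endpt_circ tc' td' (x, NW) = A1" "endpt_circ tc' td' (x, SE) = B1"
    by (simp_all add: endpt_circ_def)
  note edge_sign_local[OF T N sub sub f same]
  then show "edge_sign (crossing_at x) (face_state tc td) = perm_sign (ordr (face_state tc td)) (map (endpt_circ tc td) (reps T) @ N) *
      perm_sign (ordr (face_state tc' td')) (map (endpt_circ tc' td') (reps T') @ N) * kval (edge_kind x T T')"
    "edge_kind x T T' \<noteq> One_One \<Longrightarrow> is_Split (edge_kind x T T') \<longleftrightarrow> splits (crossing_at x) (face_state tc td)" by auto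
qed

lemma face_coef_base:
  assumes b: "b \<in> labelings D (s(c := True, d := True))"
  shows "face_coef c d s zero b + face_coef d c s zero b = 0"
proof -
  obtain m where m: "matching_ok m" "\<And>p. look m p = outer_endpt p" using ex_matching by blast
  let ?T = "table m"
  note ok = m(1)[unfolded matching_ok_def tables_ok_def]
  have em: "endpt_map m tc td (endpt_circ tc td) (\<lambda>p. ori (face_state tc td) (half_of p))" for tc td
    by (rule endpt_map_st[OF m(2)]) (use ok in \<open>cases tc; cases td; simp\<close>)
  have faith: "faithful (?T tc td) (endpt_circ tc td)" for tc td
    unfolding faithful_def using endpt_map.rep_eq_iff[OF em] endpt_map.rep_rep[OF em] by blast
  have tw: "s(d := True, c := True) = s(c := True, d := True)" using cd by (simp add: fun_upd_twist)
  have face_state_eq: "face_state False False = s" "face_state True False = s(c := True)" "face_state False True = s(d := True)"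
    "face_state True True = s(c := True, d := True)"
    using cd st by (auto simp: face_state_def fun_upd_twist fun_upd_idem)
  have rng: "range (endpt_circ tc td) = circ_of D (face_state tc td) ` range half_of" for tc td
    by (auto simp: endpt_circ_def)
  have ri: "range half_of \<subseteq> halfs D" "(c, NW) \<in> range half_of" "(c, SE) \<in> range half_of"
    "(d, NW) \<in> range half_of" "(d, SE) \<in> range half_of"
    using half_of_halfs rangeI[of half_of "(False, NW)"] rangeI[of half_of "(False, SE)"]
      rangeI[of half_of "(True, NW)"] rangeI[of half_of "(True, SE)"] by (auto simp: crossing_at_def)
  have s10: "s(c := True) \<in> states D" "\<not> (s(c := True)) d" "s(d := True) \<in> states D" "\<not> (s(d := True)) c"
    using cd st by (auto simp: states_def)
  interpret c0: framed_crossing D ori fori ordr c s "s(c := True)" by (rule framed_crossing) (use cd st in auto)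
  interpret d1: framed_crossing D ori fori ordr d "s(c := True)" "s(c := True, d := True)"
    by (rule framed_crossing) (use cd s10 in auto)
  interpret d0: framed_crossing D ori fori ordr d s "s(d := True)" by (rule framed_crossing) (use cd st in auto)
  interpret c1: framed_crossing D ori fori ordr c "s(d := True)" "s(c := True, d := True)"
    unfolding tw[symmetric] by (rule framed_crossing) (use cd s10 in auto)
  \<comment> \<open>The circles that avoid both crossings, in one order shared by the four
    corners.\<close>
  obtain N where N: "set N = circles D s - range (endpt_circ False False)" "distinct N"
    using finite_distinct_list[of "circles D s - range (endpt_circ False False)"] finite_circles[of s] by auto
  have Nt: "set N = circles D (face_state tc td) - range (endpt_circ tc td)" for tc td
    using N(1) c0.circles_away[OF ri(1-3)] d1.circles_away[OF ri(1,4,5)] d0.circles_away[OF ri(1,4,5)]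
    unfolding rng face_state_eq by (cases tc; cases td) (simp_all add: face_state_eq)
  \<comment> \<open>The factor of a corner: its chosen order compared with the order used by the
    tables.\<close>
  define g where "g tc td = perm_sign (ordr (face_state tc td)) (map (endpt_circ tc td) (reps (?T tc td)) @ N)" for tc td
  have gg: "g tc td * g tc td = 1" for tc td unfolding g_def by (rule perm_sign_square)
  have w: "edge_sign (crossing_at x) (face_state tc td) = g tc td * g tc' td' * kval (edge_kind x (?T tc td) (?T tc' td'))"
    "edge_kind x (?T tc td) (?T tc' td') \<noteq> One_One \<Longrightarrow>
      is_Split (edge_kind x (?T tc td) (?T tc' td')) \<longleftrightarrow> splits (crossing_at x) (face_state tc td)"
    if "framed_crossing D ori ordr (crossing_at x) (face_state tc td) (face_state tc' td')" "lists_ok x (?T tc td) (?T tc' td')"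
    for x tc td tc' td'
    unfolding g_def using edge_sign_edge[OF that(1) faith faith that(2) N(2) Nt Nt] by auto
  let ?e1 = "edge_kind False (?T False False) (?T True False)" and ?e2 = "edge_kind True (?T True False) (?T True True)"
    and ?e3 = "edge_kind True (?T False False) (?T False True)" and ?e4 = "edge_kind False (?T False True) (?T True True)"
  have c1: "edge_sign c s = g False False * g True False * kval ?e1" "?e1 \<noteq> One_One \<Longrightarrow> is_Split ?e1 \<longleftrightarrow> splits c s"
    using w[of False False False True False] ok c0.framed_crossing_axioms by (simp_all add: crossing_at_def face_state_eq)
  have c2: "edge_sign d (s(c := True)) = g True False * g True True * kval ?e2"
      "?e2 \<noteq> One_One \<Longrightarrow> is_Split ?e2 \<longleftrightarrow> splits d (s(c := True))"
    using w[of True True False True True] ok d1.framed_crossing_axioms by (simp_all add: crossing_at_def face_state_eq)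
  have c3: "edge_sign d s = g False False * g False True * kval ?e3" "?e3 \<noteq> One_One \<Longrightarrow> is_Split ?e3 \<longleftrightarrow> splits d s"
    using w[of True False False False True] ok d0.framed_crossing_axioms by (simp_all add: crossing_at_def face_state_eq)
  have c4: "edge_sign c (s(d := True)) = g False True * g True True * kval ?e4"
      "?e4 \<noteq> One_One \<Longrightarrow> is_Split ?e4 \<longleftrightarrow> splits c (s(d := True))"
    using w[of False False True True True] ok c1.framed_crossing_axioms by (simp_all add: crossing_at_def face_state_eq)
  let ?s2 = "s(c := True, d := True)"
  \<comment> \<open>\<open>p\<close> is the factor of the middle corner. For a one-to-one
    bifurcation \<open>is_Split\<close> and \<open>splits\<close> may disagree, but then
    \<open>kval\<close> is 0 and both sides vanish.\<close>
  have drop: "a * p * kval e * (p * a' * kval e') * F k k' = a * a' * (kval e * kval e' * F (is_Split e) (is_Split e'))"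
    if "e \<noteq> One_One \<Longrightarrow> is_Split e = k" "e' \<noteq> One_One \<Longrightarrow> is_Split e' = k'" "p * p = 1"
    for e e' k k' a a' p and F :: "bool \<Rightarrow> bool \<Rightarrow> int"
  proof -
    have "a * p * kval e * (p * a' * kval e') * F k k' = (p * p) * (a * a' * (kval e * kval e' * F k k'))"
      by (simp only: mult.assoc mult.commute mult.left_commute)
    then show ?thesis using that by (cases "e = One_One"; cases "e' = One_One") simp_all
  qed
  have "face_coef c d s zero b = g False False * g True True * (kval ?e1 * kval ?e2 *
      mulE ?s2 c (is_Split ?e1) (mulE ?s2 d (is_Split ?e2) unit_chain) b)"
    unfolding face_coef_zero[OF b] c1(1) c2(1)
    by (rule drop[where F = "\<lambda>k k'. mulE ?s2 c k (mulE ?s2 d k' unit_chain) b", OF c1(2) c2(2) gg])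
  moreover have "face_coef d c s zero b = g False False * g True True * (kval ?e3 * kval ?e4 *
      mulE ?s2 d (is_Split ?e3) (mulE ?s2 c (is_Split ?e4) unit_chain) b)"
    unfolding face.face_coef_zero[OF swap_face, unfolded tw, OF b] c3(1) c4(1)
    by (rule drop[where F = "\<lambda>k k'. mulE ?s2 d k (mulE ?s2 c k' unit_chain) b", OF c3(2) c4(2) gg])
  moreover have "kval ?e1 * kval ?e2 * mulE ?s2 c (is_Split ?e1) (mulE ?s2 d (is_Split ?e2) unit_chain) b +
    kval ?e3 * kval ?e4 * mulE ?s2 d (is_Split ?e3) (mulE ?s2 c (is_Split ?e4) unit_chain) b = 0"
  proof (rule face_sum)
    show "face_ok (?T True True) ?e1 ?e2 ?e3 ?e4" using ok by simp
    fix x q assume "q = NW \<or> q = SE"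
    then have i: "(crossing_at x, q) = half_of (x, q)" by auto
    have "circ_of D ?s2 (half_of (rep (?T True True) (x, q))) = circ_of D ?s2 (half_of (x, q))"
      using endpt_map.rep_sound(1)[OF em[of True True], of "(x, q)"] by (simp add: endpt_circ_def face_state_eq)
    moreover have "orient_sign ?s2 (half_of (x, q)) = bsgn (rep_sign (?T True True) (x, q)) * orient_sign ?s2 (half_of (rep (?T True True) (x, q)))"
      using endpt_map.rep_sound(2)[OF em[of True True], of "(x, q)"] by (simp add: orient_sign_def bsgn_def face_state_eq)
    ultimately show "mulX ?s2 (crossing_at x, q) unit_chain b =
        bsgn (rep_sign (?T True True) (x, q)) * mulX ?s2 (half_of (rep (?T True True) (x, q))) unit_chain b"
      unfolding i mulX_def by simp
  qed
  ultimately show ?thesis by (simp flip: distrib_left)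
qed

end

section \<open>The total differential\<close>

context proj_pdiag
begin

lemma coef_anticommute:
  assumes cd: "c \<in> Xs D" "d \<in> Xs D" "c \<noteq> d" and st: "s \<in> states D" "\<not> s c" "\<not> s d"
    and b: "b0 \<in> labelings D s" "b2 \<in> labelings D (s(c := True, d := True))"
  shows "(\<Sum>b1 \<in> labelings D (s(c := True)). coef D ori fori ordr c s b0 b1 * coef D ori fori ordr d (s(c := True)) b1 b2) +
    (\<Sum>b1 \<in> labelings D (s(d := True)). coef D ori fori ordr d s b0 b1 * coef D ori fori ordr c (s(d := True)) b1 b2) = 0"
proof -
  interpret face D ori fori ordr c d s by unfold_locales (use cd st in auto)
  have tw: "s(d := True, c := True) = s(c := True, d := True)" using cd by (simp add: fun_upd_twist)
  show ?thesis
    unfolding coef_comp[OF cd st] coef_comp[OF cd(2,1) cd(3)[symmetric] st(1,3,2), unfolded tw]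
    using face_coef_anticommute[OF face_coef_base b] by simp
qed

lemma deg_upd:
  assumes "c \<in> Xs D" "s c"
  shows "deg D (s(c := False)) = deg D s + 2"
proof -
  have "{x \<in> Xs D. \<not> (s(c := False)) x} = insert c {x \<in> Xs D. \<not> s x}"
    "{x \<in> Xs D. s x} = insert c {x \<in> Xs D. (s(c := False)) x}" using assms by auto
  then show ?thesis unfolding deg_def using finite_Xs assms by simp
qed

text \<open>Exchanging the summation variables shows that twice the sum is zero, which suffices over
  the integers.\<close>

lemma sum_antisym_zero:
  fixes K :: "'b \<Rightarrow> 'b \<Rightarrow> int"
  assumes "\<And>c d. c \<in> S \<Longrightarrow> d \<in> S \<Longrightarrow> K c d + K d c = 0"
  shows "(\<Sum>c\<in>S. \<Sum>d\<in>S. K c d) = 0"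
proof -
  have "(\<Sum>c\<in>S. \<Sum>d\<in>S. K c d) + (\<Sum>c\<in>S. \<Sum>d\<in>S. K c d) =
      (\<Sum>c\<in>S. \<Sum>d\<in>S. K c d) + (\<Sum>c\<in>S. \<Sum>d\<in>S. K d c)"
    by (subst (2) sum.swap) (rule refl)
  also have "\<dots> = (\<Sum>c\<in>S. \<Sum>d\<in>S. K c d + K d c)" by (simp add: sum.distrib)
  also have "\<dots> = 0" using assms by simp
  finally show ?thesis by simp
qed

lemma dd_dd_zero: "dd D ori fori ordr (i - 2) (dd D ori fori ordr i x) = (\<lambda>_. 0)"
proof
  fix sb :: "('c \<Rightarrow> bool) \<times> ('c circ \<Rightarrow> bool)"
  obtain s b2 where sb: "sb = (s, b2)" by (cases sb)
  let ?L = "labelings D"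
  let ?co = "coef D ori fori ordr"
  let ?x = "\<lambda>s b. if deg D s = i then x (s, b) else 0"
  let ?S = "{c \<in> Xs D. s c}"
  show "dd D ori fori ordr (i - 2) (dd D ori fori ordr i x) sb = 0"
  \<comment> \<open>\<open>dtot\<close> reads its argument at states with one crossing set back to
    0, whose degree is larger by 2, and the outer \<open>dd\<close> keeps only degree
    \<open>i - 2\<close>.\<close>
  proof (cases "s \<in> states D \<and> b2 \<in> ?L s \<and> deg D s + 2 = i - 2")
    case False
    then show ?thesis unfolding sb dd_def[of D ori fori ordr "i - 2"] dtot_def
      by (auto simp: deg_upd intro!: sum.neutral)
  next
    case True
    \<comment> \<open>The contribution of the paths into \<open>s\<close> that change
      \<open>d\<close> first and \<open>c\<close> second. The zero diagonal lets both sums run over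
      all of \<open>?S\<close>.\<close>
    define K where "K c d = (if c = d then 0 else \<Sum>b0 \<in> ?L (s(c := False, d := False)). ?x (s(c := False, d := False)) b0 *
      (\<Sum>b1 \<in> ?L (s(c := False)). ?co d (s(c := False, d := False)) b0 b1 * ?co c (s(c := False)) b1 b2))" for c d
    have inner: "(\<Sum>b1 \<in> ?L (s(c := False)). dd D ori fori ordr i x (s(c := False), b1) * ?co c (s(c := False)) b1 b2) =
      (\<Sum>d \<in> ?S. K c d)" if c: "c \<in> ?S" for c
    proof -
      let ?s = "s(c := False)"
      have s: "?s \<in> states D" using True by (auto simp: states_def)
      have S: "{d \<in> Xs D. ?s d} = ?S - {c}" by auto
      have "(\<Sum>b1 \<in> ?L ?s. dd D ori fori ordr i x (?s, b1) * ?co c ?s b1 b2) =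
        (\<Sum>b1 \<in> ?L ?s. \<Sum>d \<in> ?S - {c}. \<Sum>b0 \<in> ?L (?s(d := False)).
          ?x (?s(d := False)) b0 * (?co d (?s(d := False)) b0 b1 * ?co c ?s b1 b2))"
        unfolding dd_def dtot_def using s S
        by (intro sum.cong) (simp_all add: sum_distrib_right mult.assoc)
      also have "\<dots> = (\<Sum>d \<in> ?S - {c}. \<Sum>b1 \<in> ?L ?s. \<Sum>b0 \<in> ?L (?s(d := False)).
          ?x (?s(d := False)) b0 * (?co d (?s(d := False)) b0 b1 * ?co c ?s b1 b2))"
        by (rule sum.swap)
      also have "\<dots> = (\<Sum>d \<in> ?S - {c}. K c d)"
        unfolding K_def by (rule sum.cong, simp, subst sum.swap) (auto simp: sum_distrib_left)
      also have "\<dots> = (\<Sum>d \<in> ?S. K c d)"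
        using finite_Xs c by (intro sum.mono_neutral_left) (auto simp: K_def)
      finally show ?thesis .
    qed
    have anti: "K c d + K d c = 0" if cd: "c \<in> ?S" "d \<in> ?S" for c d
    proof (cases "c = d")
      case True
      then show ?thesis by (simp add: K_def)
    next
      case ne: False
      let ?s = "s(c := False, d := False)"
      have tw: "s(d := False, c := False) = ?s" using ne by (simp add: fun_upd_twist)
      have up: "?s(d := True) = s(c := False)" "?s(c := True) = s(d := False)" "?s(c := True, d := True) = s"
        using cd ne by (auto simp: fun_eq_iff)
      have sd: "s(d := True) = s" using cd by (simp add: fun_upd_idem)
      have st: "?s \<in> states D" "\<not> ?s c" "\<not> ?s d" using True by (auto simp: states_def)
      have "K c d + K d c = (\<Sum>b0 \<in> ?L ?s. ?x ?s b0 *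
         ((\<Sum>b1 \<in> ?L (s(d := False)). ?co c ?s b0 b1 * ?co d (s(d := False)) b1 b2) +
          (\<Sum>b1 \<in> ?L (s(c := False)). ?co d ?s b0 b1 * ?co c (s(c := False)) b1 b2)))"
        unfolding K_def tw using ne by (simp add: distrib_left sum.distrib add.commute)
      also have "\<dots> = 0"
      proof (rule sum.neutral, rule ballI)
        fix b0 assume b0: "b0 \<in> ?L ?s"
        have "(\<Sum>b1 \<in> ?L (s(d := False)). ?co c ?s b0 b1 * ?co d (s(d := False)) b1 b2) +
          (\<Sum>b1 \<in> ?L (s(c := False)). ?co d ?s b0 b1 * ?co c (s(c := False)) b1 b2) = 0"
          using coef_anticommute[OF _ _ ne st b0, unfolded up] cd True sd by simp
        then show "?x ?s b0 * ((\<Sum>b1 \<in> ?L (s(d := False)). ?co c ?s b0 b1 * ?co d (s(d := False)) b1 b2) +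
          (\<Sum>b1 \<in> ?L (s(c := False)). ?co d ?s b0 b1 * ?co c (s(c := False)) b1 b2)) = 0" by simp
      qed
      finally show ?thesis .
    qed
    have deg: "deg D (s(c := False)) = i - 2" if "c \<in> Xs D" "s c" for c
      using deg_upd[of c s] that True by simp
    have "dd D ori fori ordr (i - 2) (dd D ori fori ordr i x) sb =
      (\<Sum>c \<in> ?S. \<Sum>b1 \<in> ?L (s(c := False)). dd D ori fori ordr i x (s(c := False), b1) * ?co c (s(c := False)) b1 b2)"
      unfolding sb dd_def[of D ori fori ordr "i - 2"] dtot_def using True
      by (auto simp: deg intro!: sum.cong)
    also have "\<dots> = (\<Sum>c \<in> ?S. \<Sum>d \<in> ?S. K c d)" using inner by simp
    also have "\<dots> = 0" by (rule sum_antisym_zero) (rule anti)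
    finally show ?thesis .
  qed
qed

end

theorem theorem1:
  fixes D :: "'c pdiag"
    and ori :: "('c \<Rightarrow> bool) \<Rightarrow> 'c \<times> quad \<Rightarrow> bool"
    and fori :: "('c \<Rightarrow> bool) \<Rightarrow> 'c circ \<Rightarrow> bool"
    and ordr :: "('c \<Rightarrow> bool) \<Rightarrow> 'c circ list"
    and i :: int
  assumes "is_pdiag D"
    and "admissible_ori D ori"
    and "admissible_ord D ordr"
    and "x \<in> chains D i"
  shows "dd D ori fori ordr (i - 2) (dd D ori fori ordr i x) = (\<lambda>_. 0)"
proof -
  interpret proj_pdiag D ori fori ordr
    using assms(1-3) unfolding is_pdiag_def admissible_ori_def admissible_ord_def
    by unfold_locales auto
  show ?thesis by (rule dd_dd_zero)
qed

end
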